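(* Let $r,l\in\mathbb{N}$, $\mathbf{m}=(m_1,\dots,m_r)\in\mathbb{N}^r$, $m=m_1+\cdots+m_r$, $\mathbf{f}\in\mathbb{C}^r$, $\mathbf{p}=(p_1,\dots,p_l)\in\mathbb{N}^l$, $p=p_1+\cdots+p_l$, $\mathbf{h}\in\mathbb{C}^l$ and $a,b,c,d,e\in\mathbb{C}$. Suppose that $(1+a+b-c)_m\ne0$, $(c-a-m)_m\ne0$, $(c-b-m)_m\ne0$, $\Re(e-d-p)>0$ and $\Re(c+e-a-b-d-m-p)>0$. Then $$ F\left(\begin{matrix}a,b,d,\mathbf{f}+\mathbf{m},\mathbf{h}+\mathbf{p}\\c,e,\mathbf{f},\mathbf{h}\end{matrix}\right) =\Lambda\cdot F\left(\begin{matrix}c-a-m,\;c-b-m,\;d,\;\hat{\boldsymbol\zeta}+1\\c,\;e+c-a-b-m,\;\hat{\boldsymbol\zeta}\end{matrix}\;\vdots\;Y_p(1,0)\right), $$ where $$ \Lambda=\frac{\Gamma(e+c-a-b-m-d)\,\Gamma(e)}{(\mathbf{h})_{\mathbf{p}}\,\Gamma(e+c-a-b-m)\,(1+d-e-c+a+b+m)_p}, $$ $Y_p(1,0)$ denotes the polynomial $t\mapsto Y_p(1,0;t)$ with $\lambda=c-a-b-m$, and $\hat{\boldsymbol\zeta}=(\zeta_1,\dots,\zeta_m)$ is the vector of zeros of the polynomial $\hat{Q}_m(a,b,c,\mathbf{f},\mathbf{m};t)$. (Both polynomials are defined in the context.) The formula remains valid for $m=0$ if the parameters $\mathbf{f}+\mathbf{m}$,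 $\mathbf{f}$, $\hat{\boldsymbol\zeta}+1$, $\hat{\boldsymbol\zeta}$ are omitted.
   Context: Notation: $(a)_n=\Gamma(a+n)/\Gamma(a)$; for vectors, $(\mathbf{a})_n=\prod_j(a_j)_n$, $(\mathbf{h})_{\mathbf{p}}=\prod_i(h_i)_{p_i}$, and $\mathbf{a}+\beta$ means adding $\beta$ to each component. For parameter vectors $\mathbf{a},\mathbf{b}$ and a polynomial $P$, $$F\left(\begin{matrix}\mathbf{a}\\\mathbf{b}\end{matrix}\;\vdots\;P\;\Big|\;x\right)=\sum_{n\ge0}\frac{(\mathbf{a})_n}{(\mathbf{b})_n\,n!}P(n)x^n,$$ with $P\equiv1$ when $P$ is omitted (the generalized hypergeometric series); an omitted argument means $x=1$. Standing convention: lower parameters of hypergeometric functions are never non-positive integers. Polynomial $Y_p$: for $\lambda\in\mathbb{C}$, $$ Y_p(u,v;t)=\frac{(\mathbf{h}-d)_{\mathbf{p}}}{\Gamma(e-d)}\sum_{j=0}^{p}\frac{(d-e+1)_{j}}{j!}\,F\left(\begin{matrix}-j,1-\mathbf{h}+d\\1-\mathbf{h}+d-\mathbf{p}\end{matrix}\right)(ut+d)_{j}\,(vt+d-e-\lambda+j+1)_{p-j}. $$ Polynomial $\hat{Q}_m$: $$ \hat{Q}_m(a,b,c,\mathbf{f},\mathbf{m};t)=\sum_{k=0}^{m}\frac{{}_{r+1}F_{r}(-k,\mathbf{f}+\mathbf{m};\mathbf{f}\,|\,1)\,(a)_k(b)_k(t)_k}{(c-a-m)_k(c-b-m)_k\,k!}\;{}_{3}F_{2}\left(\begin{matrix}-m+k,\;t+k,\;c-a-b-m\\c-a-m+k,\;c-b-m+k\end{matrix}\,\Big|\,1\right).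 $$ Zeros are listed with multiplicity; as implicit in the notation $(\zeta_1,\dots,\zeta_m)$, $\hat{Q}_m$ is taken to have exact degree $m$. *)

theory Defs
  imports "HOL-Analysis.Analysis"
begin

text \<open>
  The parameter vectors are lists. A polynomial weight \<open>P\<close> is evaluated at the summation
  index; the coefficient of the series itself is the one of the library's formal hypergeometric
  series \<open>fps_hypergeo\<close>.
\<close>

definition hypergeom_term ::
    "complex list \<Rightarrow> complex list \<Rightarrow> complex poly \<Rightarrow> complex \<Rightarrow> nat \<Rightarrow> complex" where
  "hypergeom_term as bs P x n =
     fps_nth (fps_hypergeo as bs 1) n * poly P (of_nat n) * x ^ n"

definition hypergeom_weighted ::
    "complex list \<Rightarrow> complex list \<Rightarrow> complex poly \<Rightarrow> complex \<Rightarrow> complex" where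
  "hypergeom_weighted as bs P x = (\<Sum>n. hypergeom_term as bs P x n)"

abbreviation hypergeom :: "complex list \<Rightarrow> complex list \<Rightarrow> complex \<Rightarrow> complex" where
  "hypergeom as bs x \<equiv> hypergeom_weighted as bs 1 x"

lemma foldl_mult_eq_prod_list:
  fixes g :: "'a \<Rightarrow> 'b::comm_monoid_mult"
  shows "foldl (\<lambda>r a. r * g a) z xs = z * (\<Prod>a\<leftarrow>xs. g a)"
  by (induction xs arbitrary: z) (simp_all add: mult.assoc)

lemma hypergeom_term_eq:
  "hypergeom_term as bs P x n =
     (\<Prod>a\<leftarrow>as. pochhammer a n) / ((\<Prod>b\<leftarrow>bs. pochhammer b n) * fact n) * poly P (of_nat n) * x ^ n"
  by (simp add: hypergeom_term_def foldl_mult_eq_prod_list)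

definition pochhammer_vec :: "complex list \<Rightarrow> nat list \<Rightarrow> complex" where
  "pochhammer_vec hs ps = prod_list (map2 pochhammer hs ps)"

text \<open>
  The polynomial \<open>Y\<^sub>p(u,v;t)\<close> in \<open>t\<close>; the linear polynomials \<open>ut + d\<close> and
  \<open>vt + d - e - lam + j + 1\<close> are written as coefficient lists.
\<close>

definition Y_poly ::
    "complex list \<Rightarrow> nat list \<Rightarrow> complex \<Rightarrow> complex \<Rightarrow> complex \<Rightarrow> complex \<Rightarrow> complex \<Rightarrow> complex poly" where
  "Y_poly hs ps d e lam u v =
     smult (pochhammer_vec (map (\<lambda>h. h - d) hs) ps / Gamma (e - d))
       (\<Sum>j\<le>sum_list ps.
          smult (pochhammer (d - e + 1) j / fact j *
                 hypergeom (- of_nat j # map (\<lambda>h. 1 - h + d) hs)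
                           (map2 (\<lambda>h q. 1 - h + d - of_nat q) hs ps) 1)
            (pochhammer [:d, u:] j *
             pochhammer [:d - e - lam + of_nat j + 1, v:] (sum_list ps - j)))"

lemma poly_pochhammer: "poly (pochhammer q n) t = pochhammer (poly q t) n"
  for q :: "'a::comm_ring_1 poly"
  by (simp add: pochhammer_prod poly_prod)

lemma poly_Y_poly:
  "poly (Y_poly hs ps d e lam u v) t =
     pochhammer_vec (map (\<lambda>h. h - d) hs) ps / Gamma (e - d) *
       (\<Sum>j\<le>sum_list ps.
          pochhammer (d - e + 1) j / fact j *
          hypergeom (- of_nat j # map (\<lambda>h. 1 - h + d) hs)
                    (map2 (\<lambda>h q. 1 - h + d - of_nat q) hs ps) 1 *
          pochhammer (u * t + d) j *
          pochhammer (v * t + d - e - lam + of_nat j + 1) (sum_list ps - j))"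
  by (simp add: Y_poly_def poly_sum poly_pochhammer algebra_simps)

text \<open>
  \<open>Q_hat\<close> is the defining expression as a function of \<open>t\<close>, where \<open>t\<close> also occurs as a parameter
  of a (terminating) hypergeometric series; \<open>Q_hat_poly\<close> is the polynomial with these values,
  which exists by \<open>poly_Q_hat_poly\<close> below.
\<close>

definition Q_hat ::
    "complex \<Rightarrow> complex \<Rightarrow> complex \<Rightarrow> complex list \<Rightarrow> nat list \<Rightarrow> complex \<Rightarrow> complex" where
  "Q_hat a b c f ms t = (let m = sum_list ms in
     \<Sum>k\<le>m.
       hypergeom (- of_nat k # map2 (\<lambda>y q. y + of_nat q) f ms) f 1 *
       pochhammer a k * pochhammer b k * pochhammer t k /
       (pochhammer (c - a - of_nat m) k * pochhammer (c - b - of_nat m) k * fact k) *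
       hypergeom [- of_nat m + of_nat k, t + of_nat k, c - a - b - of_nat m]
                 [c - a - of_nat m + of_nat k, c - b - of_nat m + of_nat k] 1)"

definition Q_hat_poly ::
    "complex \<Rightarrow> complex \<Rightarrow> complex \<Rightarrow> complex list \<Rightarrow> nat list \<Rightarrow> complex poly" where
  "Q_hat_poly a b c f ms = (THE q. \<forall>t. poly q t = Q_hat a b c f ms t)"

lemma hypergeom_terminating:
  assumes "- of_nat N \<in> set as"
  shows "hypergeom_weighted as bs P x = (\<Sum>n\<le>N. hypergeom_term as bs P x n)"
  unfolding hypergeom_weighted_def
proof (rule suminf_finite)
  fix n assume "n \<notin> {..N}"
  then have "pochhammer (- of_nat N :: complex) n = 0"
    by (simp add: pochhammer_of_nat_eq_0_iff)
  then have "(\<Prod>a\<leftarrow>as. pochhammer a n) = 0"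
    using assms by (force simp: prod_list_zero_iff)
  then show "hypergeom_term as bs P x n = 0"
    by (simp add: hypergeom_term_eq)
qed simp

lemma poly_Q_hat_poly: "poly (Q_hat_poly a b c f ms) t = Q_hat a b c f ms t"
proof -
  define m where "m = sum_list ms"
  define A where "A k = hypergeom (- of_nat k # map2 (\<lambda>y q. y + of_nat q) f ms) f 1 *
       pochhammer a k * pochhammer b k /
       (pochhammer (c - a - of_nat m) k * pochhammer (c - b - of_nat m) k * fact k)" for k
  define B where "B k n = pochhammer (- of_nat m + of_nat k) n *
       pochhammer (c - a - b - of_nat m) n /
       (pochhammer (c - a - of_nat m + of_nat k) n *
        pochhammer (c - b - of_nat m + of_nat k) n * fact n)" for k n
  define q where "q = (\<Sum>k\<le>m. smult (A k) (pochhammer [:0, 1:] k *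
       (\<Sum>n\<le>m - k. smult (B k n) (pochhammer [:of_nat k, 1:] n))))"
  have q: "poly q t = Q_hat a b c f ms t" for t
  proof -
    have "Q_hat a b c f ms t = (\<Sum>k\<le>m. A k * (pochhammer t k *
            (\<Sum>n\<le>m - k. B k n * pochhammer (t + of_nat k) n)))"
      unfolding Q_hat_def Let_def m_def [symmetric]
    proof (rule sum.cong [OF refl])
      fix k assume "k \<in> {..m}"
      then have "- of_nat m + of_nat k = (- of_nat (m - k) :: complex)"
        by (simp add: of_nat_diff)
      then have "hypergeom [- of_nat m + of_nat k, t + of_nat k, c - a - b - of_nat m]
          [c - a - of_nat m + of_nat k, c - b - of_nat m + of_nat k] 1 =
          (\<Sum>n\<le>m - k. hypergeom_term
            [- of_nat m + of_nat k, t + of_nat k, c - a - b - of_nat m]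
            [c - a - of_nat m + of_nat k, c - b - of_nat m + of_nat k] 1 1 n)"
        by (intro hypergeom_terminating) simp
      also have "\<dots> = (\<Sum>n\<le>m - k. B k n * pochhammer (t + of_nat k) n)"
        by (intro sum.cong refl) (simp add: hypergeom_term_eq B_def mult_ac)
      finally show "hypergeom (- of_nat k # map2 (\<lambda>y q. y + of_nat q) f ms) f 1 *
          pochhammer a k * pochhammer b k * pochhammer t k /
          (pochhammer (c - a - of_nat m) k * pochhammer (c - b - of_nat m) k * fact k) *
          hypergeom [- of_nat m + of_nat k, t + of_nat k, c - a - b - of_nat m]
            [c - a - of_nat m + of_nat k, c - b - of_nat m + of_nat k] 1 =
          A k * (pochhammer t k * (\<Sum>n\<le>m - k. B k n * pochhammer (t + of_nat k) n))"
        by (simp add: A_def mult_ac)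
    qed
    then show ?thesis
      by (simp add: q_def poly_sum poly_pochhammer add.commute)
  qed
  have "\<exists>!q. \<forall>t. poly q t = Q_hat a b c f ms t"
  proof (rule ex1I)
    show "\<forall>t. poly q t = Q_hat a b c f ms t"
      using q by blast
  next
    fix q' assume "\<forall>t. poly q' t = Q_hat a b c f ms t"
    then have "poly q' = poly q"
      using q by auto
    then show "q' = q"
      by (simp add: poly_eq_poly_eq_iff)
  qed
  from theI' [OF this] show ?thesis
    unfolding Q_hat_poly_def by blast
qed

end

theory Submission
  imports Defs "HOL-Computational_Algebra.Fundamental_Theorem_Algebra"
begin

text \<open>
  Put \<open>l = c - a - b - m\<close>, and let \<open>u n\<close> be the \<open>n\<close>-th coefficient of \<open>F(a, b, f + m; c, f; x)\<close>.
  Expanding \<open>(f + m)\<^sub>n / (f)\<^sub>n\<close> in falling factorials of \<open>n\<close> and transforming each summand by repeated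
  use of Vandermonde's identity shows that the coefficients \<open>v n\<close> of \<open>(1 - x)\<close> to the power \<open>- l\<close>
  times this series are \<open>(c - a - m)\<^sub>n (c - b - m)\<^sub>n / ((c)\<^sub>n n!) * Q_hat (- n)\<close>, and
  \<open>Q_hat (- n)\<close> is \<open>(\<zeta> + 1)\<^sub>n / (\<zeta>)\<^sub>n\<close> because \<open>Q_hat 0 = 1\<close>. Conversely \<open>u\<close> is the convolution
  of \<open>v\<close> with \<open>(- l)\<^sub>n / n!\<close>; inserting this into the sum of \<open>u n * (d)\<^sub>n / (e)\<^sub>n\<close> and exchanging the
  sums leaves inner series that Gauss's theorem evaluates, which is the case \<open>p = 0\<close>.
  In general \<open>(h + n)\<^sub>p\<close> is expanded in \<open>(d + n)\<^sub>j\<close> with \<open>j \<le> p\<close> by Newton interpolation at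
  \<open>- d, - d - 1, \<dots>\<close>, and the case \<open>p = 0\<close> is applied with \<open>d + j\<close> in place of \<open>d\<close>.
\<close>

section \<open>Finite hypergeometric identities\<close>

text \<open>Trinomial revision followed by the shift i = j + r. After two sums have been exchanged,
  it leaves an inner sum of the shape that Vandermonde's identity evaluates.\<close>

lemma sum_binomial_shift:
  fixes X :: "nat \<Rightarrow> 'a::comm_semiring_1"
  shows "(\<Sum>i\<le>N. of_nat (N choose i) * of_nat (i choose j) * X i) =
    of_nat (N choose j) * (\<Sum>r\<le>N - j. of_nat ((N - j) choose r) * X (j + r))"
proof (cases "j \<le> N")
  case True
  have "(\<Sum>i\<le>N. of_nat (N choose i) * of_nat (i choose j) * X i) =
      (\<Sum>i\<in>{j..N}. of_nat (N choose i) * of_nat (i choose j) * X i)"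
    by (rule sum.mono_neutral_right) (auto simp: binomial_eq_0)
  also have "\<dots> = (\<Sum>r\<le>N - j. of_nat (N choose (j + r)) * of_nat ((j + r) choose j) * X (j + r))"
    by (rule sum.reindex_bij_witness[of _ "\<lambda>r. j + r" "\<lambda>i. i - j"]) (use True in auto)
  also have "\<dots> = (\<Sum>r\<le>N - j. of_nat (N choose j) * (of_nat ((N - j) choose r) * X (j + r)))"
  proof (rule sum.cong[OF refl])
    fix r assume "r \<in> {..N - j}"
    then have "(N choose (j + r)) * ((j + r) choose j) = (N choose j) * ((N - j) choose r)"
      using True choose_mult[of j "j + r" N] by simp
    then have "of_nat (N choose (j + r)) * of_nat ((j + r) choose j) =
        (of_nat (N choose j) * of_nat ((N - j) choose r) :: 'a)"
      by (metis of_nat_mult)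
    then show "of_nat (N choose (j + r)) * of_nat ((j + r) choose j) * X (j + r) =
        of_nat (N choose j) * (of_nat ((N - j) choose r) * X (j + r))"
      by (simp only: mult.assoc)
  qed
  finally show ?thesis
    by (simp add: sum_distrib_left)
next
  case False
  then show ?thesis
    by (auto intro!: sum.neutral simp: binomial_eq_0)
qed

lemma pochhammer_minus_of_nat:
  "pochhammer (- of_nat n) k = (-1) ^ k * fact k * (of_nat (n choose k) :: 'a::field_char_0)"
  by (simp add: binomial_gbinomial gbinomial_pochhammer)

text \<open>Chu-Vandermonde with cleared denominators. Reflection gives (c - b)_n = (-1)^n (b + (1 -
  c - n))_n, the binomial theorem for rising factorials expands this, and each factor in 1 - c - n
  is reflected back.\<close>

lemma pochhammer_diff_binomial_sum:
  fixes b c :: "'a::comm_ring_1"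
  shows "pochhammer (c - b) n =
    (\<Sum>i\<le>n. of_nat (n choose i) * (-1) ^ i * pochhammer b i * pochhammer (c + of_nat i) (n - i))"
proof -
  have "pochhammer (c - b) n = (-1) ^ n * pochhammer (b + (1 - c - of_nat n)) n"
    using pochhammer_minus[of "b - c" n] by (simp add: algebra_simps)
  also have "\<dots> = (-1) ^ n *
      (\<Sum>i\<le>n. of_nat (n choose i) * pochhammer b i * pochhammer (1 - c - of_nat n) (n - i))"
    by (simp only: pochhammer_binomial_sum)
  also have "\<dots> = (\<Sum>i\<le>n. of_nat (n choose i) * (-1) ^ i * pochhammer b i *
      pochhammer (c + of_nat i) (n - i))"
    unfolding sum_distrib_left
  proof (rule sum.cong[OF refl])
    fix i assume "i \<in> {..n}"
    then obtain r where n: "n = i + r"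
      using nat_le_iff_add by auto
    have "pochhammer (1 - c - of_nat n) r = (-1) ^ r * pochhammer (c + of_nat i) r"
      using pochhammer_minus[of "c + of_nat n - 1" r] by (simp add: n algebra_simps)
    then show "(-1) ^ n * (of_nat (n choose i) * pochhammer b i * pochhammer (1 - c - of_nat n) (n - i)) =
        of_nat (n choose i) * (-1) ^ i * pochhammer b i * pochhammer (c + of_nat i) (n - i)"
      by (simp add: n power_add mult_ac)
  qed
  finally show ?thesis .
qed

text \<open>The sum is F(-n, b; c; 1). Its upper limit may be any \<open>N\<close> beyond
  \<open>n\<close>, because the extra binomials vanish; a common limit makes exchanges of double
  sums immediate.\<close>

lemma chu_vandermonde:
  fixes b c :: "'a::field_char_0"
  assumes "pochhammer c n \<noteq> 0" "n \<le> N"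
  shows "pochhammer (c - b) n / pochhammer c n =
    (\<Sum>i\<le>N. of_nat (n choose i) * (-1) ^ i * pochhammer b i / pochhammer c i)"
proof -
  have "(\<Sum>i\<le>N. of_nat (n choose i) * (-1) ^ i * pochhammer b i / pochhammer c i) =
      (\<Sum>i\<le>n. of_nat (n choose i) * (-1) ^ i * pochhammer b i / pochhammer c i)"
    by (rule sum.mono_neutral_right) (use assms in \<open>auto simp: binomial_eq_0\<close>)
  also have "\<dots> = (\<Sum>i\<le>n. of_nat (n choose i) * (-1) ^ i * pochhammer b i *
      pochhammer (c + of_nat i) (n - i) / pochhammer c n)"
  proof (rule sum.cong[OF refl])
    fix i assume i: "i \<in> {..n}"
    then have "pochhammer c n = pochhammer c i * pochhammer (c + of_nat i) (n - i)"
      by (intro pochhammer_product) auto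
    then show "of_nat (n choose i) * (-1) ^ i * pochhammer b i / pochhammer c i =
        of_nat (n choose i) * (-1) ^ i * pochhammer b i *
          pochhammer (c + of_nat i) (n - i) / pochhammer c n"
      using assms(1) by (simp add: field_simps)
  qed
  finally show ?thesis
    by (simp add: pochhammer_diff_binomial_sum sum_divide_distrib)
qed

text \<open>Coefficient form of Pfaff's transformation: up to N!, both sides are the coefficient of
  x^N in (1 - x)^(-l) F(a, b; c; x) = (1 - x)^(-l - a) F(a, c - b; c; x / (x - 1)). Chu-Vandermonde
  expands (b)_i / (c)_i, and after exchanging the sums the inner one is Vandermonde's.\<close>

lemma pfaff_coeff:
  fixes a b c l :: "'a::field_char_0"
  assumes c: "pochhammer c N \<noteq> 0"
  shows "(\<Sum>i\<le>N. of_nat (N choose i) * pochhammer l (N - i) *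
        (pochhammer a i * pochhammer b i / pochhammer c i)) =
    (\<Sum>j\<le>N. of_nat (N choose j) * (-1) ^ j * (pochhammer a j * pochhammer (c - b) j / pochhammer c j) *
        pochhammer (l + a + of_nat j) (N - j))"
proof -
  have "(\<Sum>i\<le>N. of_nat (N choose i) * pochhammer l (N - i) *
        (pochhammer a i * pochhammer b i / pochhammer c i)) =
      (\<Sum>i\<le>N. \<Sum>j\<le>N. (-1) ^ j * (pochhammer (c - b) j / pochhammer c j) *
         (of_nat (N choose i) * of_nat (i choose j) * (pochhammer l (N - i) * pochhammer a i)))"
  proof (rule sum.cong[OF refl])
    fix i assume i: "i \<in> {..N}"
    then have "pochhammer c i \<noteq> 0"
      using pochhammer_neq_0_mono[OF c] by simp
    from chu_vandermonde[OF this, of N "c - b"] i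
    have "pochhammer b i / pochhammer c i =
        (\<Sum>j\<le>N. of_nat (i choose j) * (-1) ^ j * pochhammer (c - b) j / pochhammer c j)"
      by simp
    note ratio = this
    have "of_nat (N choose i) * pochhammer l (N - i) *
        (pochhammer a i * pochhammer b i / pochhammer c i) =
        of_nat (N choose i) * pochhammer l (N - i) * pochhammer a i * (pochhammer b i / pochhammer c i)"
      by simp
    also note ratio
    also have "of_nat (N choose i) * pochhammer l (N - i) * pochhammer a i *
        (\<Sum>j\<le>N. of_nat (i choose j) * (-1) ^ j * pochhammer (c - b) j / pochhammer c j) =
        (\<Sum>j\<le>N. (-1) ^ j * (pochhammer (c - b) j / pochhammer c j) *
         (of_nat (N choose i) * of_nat (i choose j) * (pochhammer l (N - i) * pochhammer a i)))"
      by (simp add: sum_distrib_left mult_ac)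
    finally show "of_nat (N choose i) * pochhammer l (N - i) *
        (pochhammer a i * pochhammer b i / pochhammer c i) = \<dots>" .
  qed
  also have "\<dots> = (\<Sum>j\<le>N. (-1) ^ j * (pochhammer (c - b) j / pochhammer c j) *
      (\<Sum>i\<le>N. of_nat (N choose i) * of_nat (i choose j) * (pochhammer l (N - i) * pochhammer a i)))"
    by (subst sum.swap) (simp add: sum_distrib_left)
  also have "\<dots> = (\<Sum>j\<le>N. of_nat (N choose j) * (-1) ^ j *
        (pochhammer a j * pochhammer (c - b) j / pochhammer c j) *
        pochhammer (l + a + of_nat j) (N - j))"
  proof (rule sum.cong[OF refl])
    fix j
    have "(\<Sum>i\<le>N. of_nat (N choose i) * of_nat (i choose j) * (pochhammer l (N - i) * pochhammer a i)) =
        of_nat (N choose j) * pochhammer a j * (\<Sum>r\<le>N - j. of_nat ((N - j) choose r) *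
           pochhammer (a + of_nat j) r * pochhammer l (N - j - r))"
      unfolding sum_binomial_shift by (simp add: pochhammer_product' sum_distrib_left mult_ac)
    also have "\<dots> = of_nat (N choose j) * pochhammer a j * pochhammer (a + of_nat j + l) (N - j)"
      by (simp only: pochhammer_binomial_sum)
    finally show "(-1) ^ j * (pochhammer (c - b) j / pochhammer c j) *
      (\<Sum>i\<le>N. of_nat (N choose i) * of_nat (i choose j) * (pochhammer l (N - i) * pochhammer a i)) =
      of_nat (N choose j) * (-1) ^ j *
        (pochhammer a j * pochhammer (c - b) j / pochhammer c j) *
        pochhammer (l + a + of_nat j) (N - j)"
      by (simp add: add_ac)
  qed
  finally show ?thesis .
qed

text \<open>The left-hand side is, up to \<open>N!\<close>, a coefficient of \<open>(1 - x) powr (- l) * F(a, b; c; x)\<close>;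
  \<open>M = 0\<close> is Euler's transformation.\<close>

lemma euler_coeff:
  fixes a b c l A B :: "'a::field_char_0"
  assumes c: "pochhammer c N \<noteq> 0" and A: "pochhammer A M \<noteq> 0" and B: "pochhammer B M \<noteq> 0"
    and eqs: "a = B - l" "c - b = B + of_nat M" "c - a = A + of_nat M"
  shows "(\<Sum>i\<le>N. of_nat (N choose i) * pochhammer l (N - i) *
        (pochhammer a i * pochhammer b i / pochhammer c i)) =
    pochhammer A N * pochhammer B N / pochhammer c N *
    (\<Sum>j\<le>M. of_nat (M choose j) * of_nat (N choose j) * fact j *
       pochhammer l j / (pochhammer A j * pochhammer B j))"
proof -
  have Aj: "pochhammer A j \<noteq> 0" and Bj: "pochhammer B j \<noteq> 0" if "j \<le> M" for j
    using that pochhammer_neq_0_mono A B by blast+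
  define S where "S j = (-1) ^ j * (pochhammer a j / pochhammer c j)" for j
  have "(\<Sum>i\<le>N. of_nat (N choose i) * pochhammer l (N - i) *
        (pochhammer a i * pochhammer b i / pochhammer c i)) =
    (\<Sum>j\<le>N. of_nat (N choose j) * (-1) ^ j * (pochhammer a j * pochhammer (c - b) j / pochhammer c j) *
        pochhammer (l + a + of_nat j) (N - j))"
    by (rule pfaff_coeff[OF c])
  also have "\<dots> = (\<Sum>j\<le>N. \<Sum>i\<le>M. pochhammer B N * (of_nat (M choose i) * fact i / pochhammer B i) *
      (of_nat (N choose j) * of_nat (j choose i) * S j))"
  proof (rule sum.cong[OF refl])
    fix j assume j: "j \<in> {..N}"
    \<comment> \<open>Since c - b = B + M and l + a = B, the two factors combine to (B)_N (B + j)_M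
      / (B)_M. Chu-Vandermonde with -j in place of b then turns the dependence on j into binomials
      (j choose i), which allows another exchange of sums.\<close>
    have "pochhammer B M * (pochhammer (B + of_nat M) j * pochhammer (B + of_nat j) (N - j)) =
        pochhammer B (M + j) * pochhammer (B + of_nat j) (N - j)"
      by (simp add: pochhammer_product')
    also have "\<dots> = pochhammer B j * pochhammer (B + of_nat j) (N - j) * pochhammer (B + of_nat j) M"
      by (subst add.commute) (simp add: pochhammer_product')
    also have "\<dots> = pochhammer B N * pochhammer (B + of_nat j) M"
      using pochhammer_product[of j N B] j by simp
    finally have "pochhammer (B + of_nat M) j * pochhammer (B + of_nat j) (N - j) =
        pochhammer B N * (pochhammer (B - (- of_nat j)) M / pochhammer B M)"
      using B by (simp add: field_simps)
    also have "pochhammer (B - (- of_nat j)) M / pochhammer B M =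
        (\<Sum>i\<le>M. of_nat (M choose i) * (-1) ^ i * pochhammer (- of_nat j) i / pochhammer B i)"
      by (rule chu_vandermonde[OF B]) simp
    also have "\<dots> = (\<Sum>i\<le>M. of_nat (M choose i) * fact i / pochhammer B i * of_nat (j choose i))"
      by (simp add: pochhammer_minus_of_nat mult_ac)
    finally have *: "pochhammer (c - b) j * pochhammer (l + a + of_nat j) (N - j) =
        pochhammer B N * (\<Sum>i\<le>M. of_nat (M choose i) * fact i / pochhammer B i * of_nat (j choose i))"
      by (simp add: eqs)
    have "of_nat (N choose j) * (-1) ^ j * (pochhammer a j * pochhammer (c - b) j / pochhammer c j) *
        pochhammer (l + a + of_nat j) (N - j) = of_nat (N choose j) * S j *
        (pochhammer (c - b) j * pochhammer (l + a + of_nat j) (N - j))"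
      by (simp add: S_def)
    also have "\<dots> = (\<Sum>i\<le>M. pochhammer B N * (of_nat (M choose i) * fact i / pochhammer B i) *
      (of_nat (N choose j) * of_nat (j choose i) * S j))"
      unfolding * by (simp add: sum_distrib_left mult_ac)
    finally show "of_nat (N choose j) * (-1) ^ j * (pochhammer a j * pochhammer (c - b) j / pochhammer c j) *
        pochhammer (l + a + of_nat j) (N - j) = \<dots>" .
  qed
  also have "\<dots> = (\<Sum>i\<le>M. pochhammer B N * (of_nat (M choose i) * fact i / pochhammer B i) *
      (\<Sum>j\<le>N. of_nat (N choose j) * of_nat (j choose i) * S j))"
    by (subst sum.swap) (simp add: sum_distrib_left)
  also have "\<dots> = (\<Sum>i\<le>M. pochhammer B N / pochhammer c N * (of_nat (M choose i) * of_nat (N choose i) *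
      fact i * (-1) ^ i * (pochhammer a i / pochhammer B i) * pochhammer (c - a) (N - i)))"
  proof (rule sum.cong[OF refl])
    fix i assume i: "i \<in> {..M}"
    show "pochhammer B N * (of_nat (M choose i) * fact i / pochhammer B i) *
      (\<Sum>j\<le>N. of_nat (N choose j) * of_nat (j choose i) * S j) =
      pochhammer B N / pochhammer c N * (of_nat (M choose i) * of_nat (N choose i) *
      fact i * (-1) ^ i * (pochhammer a i / pochhammer B i) * pochhammer (c - a) (N - i))"
    proof (cases "i \<le> N")
      case True
      have cN: "pochhammer c N = pochhammer c i * pochhammer (c + of_nat i) (N - i)"
        by (rule pochhammer_product[OF True])
      with c have ci: "pochhammer (c + of_nat i) (N - i) \<noteq> 0" "pochhammer c i \<noteq> 0"
        by auto
      \<comment> \<open>After the shift by i this is F(-(N - i), a + i; c + i; 1).\<close>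
      have "(\<Sum>j\<le>N. of_nat (N choose j) * of_nat (j choose i) * S j) =
          of_nat (N choose i) * S i * (\<Sum>r\<le>N - i. of_nat ((N - i) choose r) * (-1) ^ r *
            pochhammer (a + of_nat i) r / pochhammer (c + of_nat i) r)"
        unfolding sum_binomial_shift
        by (simp add: S_def pochhammer_product' sum_distrib_left power_add mult_ac)
      also have "(\<Sum>r\<le>N - i. of_nat ((N - i) choose r) * (-1) ^ r *
            pochhammer (a + of_nat i) r / pochhammer (c + of_nat i) r) =
          pochhammer (c - a) (N - i) / pochhammer (c + of_nat i) (N - i)"
        using chu_vandermonde[OF ci(1) order_refl, of "a + of_nat i"] by simp
      finally have inner: "(\<Sum>j\<le>N. of_nat (N choose j) * of_nat (j choose i) * S j) =
          of_nat (N choose i) * S i * (pochhammer (c - a) (N - i) / pochhammer (c + of_nat i) (N - i))" .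
      show ?thesis
        unfolding inner by (simp add: S_def cN mult_ac)
    qed (auto intro!: sum.neutral simp: binomial_eq_0)
  qed
  also have "\<dots> = (\<Sum>i\<le>M. \<Sum>j\<le>M. pochhammer B N / pochhammer c N *
      ((-1) ^ j * (pochhammer l j / pochhammer B j) * (of_nat (M choose i) * of_nat (i choose j) *
        (of_nat (N choose i) * fact i * (-1) ^ i * pochhammer (c - a) (N - i)))))"
  proof (rule sum.cong[OF refl])
    fix i assume i: "i \<in> {..M}"
    \<comment> \<open>Because a = B - l, a third use of Chu-Vandermonde introduces the factors (l)_j
      of the right-hand side.\<close>
    have ratio: "pochhammer a i / pochhammer B i =
        (\<Sum>j\<le>M. of_nat (i choose j) * (-1) ^ j * pochhammer l j / pochhammer B j)"
      using chu_vandermonde[OF Bj, of i M l] i by (simp add: eqs)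
    show "pochhammer B N / pochhammer c N * (of_nat (M choose i) * of_nat (N choose i) *
      fact i * (-1) ^ i * (pochhammer a i / pochhammer B i) * pochhammer (c - a) (N - i)) =
      (\<Sum>j\<le>M. pochhammer B N / pochhammer c N *
      ((-1) ^ j * (pochhammer l j / pochhammer B j) * (of_nat (M choose i) * of_nat (i choose j) *
        (of_nat (N choose i) * fact i * (-1) ^ i * pochhammer (c - a) (N - i)))))"
      unfolding ratio by (simp add: sum_distrib_left sum_distrib_right mult_ac)
  qed
  also have "\<dots> = (\<Sum>j\<le>M. pochhammer B N / pochhammer c N * ((-1) ^ j * (pochhammer l j / pochhammer B j) *
      (\<Sum>i\<le>M. of_nat (M choose i) * of_nat (i choose j) *
        (of_nat (N choose i) * fact i * (-1) ^ i * pochhammer (c - a) (N - i)))))"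
    by (subst sum.swap) (simp add: sum_distrib_left)
  also have "\<dots> = (\<Sum>j\<le>M. pochhammer B N / pochhammer c N * (pochhammer A N *
      (of_nat (M choose j) * of_nat (N choose j) * fact j *
       pochhammer l j / (pochhammer A j * pochhammer B j))))"
  proof (rule sum.cong[OF refl])
    fix j assume "j \<in> {..M}"
    then have j: "j \<le> M" by simp
    have "(\<Sum>i\<le>M. of_nat (M choose i) * of_nat (i choose j) *
        (of_nat (N choose i) * fact i * (-1) ^ i * pochhammer (c - a) (N - i))) =
        of_nat (M choose j) * (\<Sum>r\<le>M - j. of_nat ((M - j) choose r) *
          (of_nat (N choose (j + r)) * fact (j + r) * (-1) ^ (j + r) * pochhammer (c - a) (N - (j + r))))"
      by (rule sum_binomial_shift)
    also have "(\<Sum>r\<le>M - j. of_nat ((M - j) choose r) *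
          (of_nat (N choose (j + r)) * fact (j + r) * (-1) ^ (j + r) * pochhammer (c - a) (N - (j + r)))) =
        (-1) ^ j * fact j * of_nat (N choose j) * (pochhammer A N / pochhammer A j)"
    proof (cases "j \<le> N")
      case True
      have fall: "of_nat (N choose (j + r)) * fact (j + r) =
          of_nat (N choose j) * fact j * (of_nat ((N - j) choose r) * (fact r :: 'a))" for r
      proof -
        have "pochhammer (- of_nat N :: 'a) (j + r) =
            pochhammer (- of_nat N) j * pochhammer (- of_nat (N - j)) r"
          using True by (simp add: pochhammer_product' of_nat_diff)
        then show ?thesis
          by (simp add: pochhammer_minus_of_nat power_add mult_ac)
      qed
      have "(\<Sum>r\<le>M - j. of_nat ((M - j) choose r) *
          (of_nat (N choose (j + r)) * fact (j + r) * (-1) ^ (j + r) * pochhammer (c - a) (N - (j + r)))) =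
          (\<Sum>r\<le>M - j. (-1) ^ j * fact j * of_nat (N choose j) * (of_nat ((N - j) choose r) *
             pochhammer (- of_nat (M - j)) r * pochhammer (c - a) (N - j - r)))"
        unfolding fall by (simp add: pochhammer_minus_of_nat power_add mult_ac)
      \<comment> \<open>The summand vanishes for r > N - j through the binomial and for r > M - j
        through the Pochhammer symbol of -(M - j), so either limit is allowed. With N - j the sum is
        Vandermonde's.\<close>
      also have "\<dots> = (\<Sum>r\<le>N - j. (-1) ^ j * fact j * of_nat (N choose j) * (of_nat ((N - j) choose r) *
             pochhammer (- of_nat (M - j)) r * pochhammer (c - a) (N - j - r)))"
        by (rule sum.mono_neutral_cong)
           (auto simp: pochhammer_minus_of_nat binomial_eq_0)
      also have "\<dots> = (-1) ^ j * fact j * of_nat (N choose j) *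
          pochhammer (- of_nat (M - j) + (c - a)) (N - j)"
        by (simp only: pochhammer_binomial_sum sum_distrib_left)
      also have "- of_nat (M - j) + (c - a) = A + of_nat j"
        using j by (simp add: eqs(3) of_nat_diff)
      also have "pochhammer (A + of_nat j) (N - j) = pochhammer A N / pochhammer A j"
        using pochhammer_product[OF True, of A] Aj[OF j] by simp
      finally show ?thesis .
    qed (auto intro!: sum.neutral simp: binomial_eq_0)
    finally have eq: "(\<Sum>i\<le>M. of_nat (M choose i) * of_nat (i choose j) *
        (of_nat (N choose i) * fact i * (-1) ^ i * pochhammer (c - a) (N - i))) =
        (-1) ^ j * (of_nat (M choose j) * fact j * of_nat (N choose j) * (pochhammer A N / pochhammer A j))"
      by (simp add: mult_ac)
    show "pochhammer B N / pochhammer c N * ((-1) ^ j * (pochhammer l j / pochhammer B j) *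
      (\<Sum>i\<le>M. of_nat (M choose i) * of_nat (i choose j) *
        (of_nat (N choose i) * fact i * (-1) ^ i * pochhammer (c - a) (N - i)))) =
      pochhammer B N / pochhammer c N * (pochhammer A N *
      (of_nat (M choose j) * of_nat (N choose j) * fact j *
       pochhammer l j / (pochhammer A j * pochhammer B j)))"
      unfolding eq by (simp add: mult_ac)
  qed
  also have "\<dots> = pochhammer A N * pochhammer B N / pochhammer c N *
    (\<Sum>j\<le>M. of_nat (M choose j) * of_nat (N choose j) * fact j *
       pochhammer l j / (pochhammer A j * pochhammer B j))"
    by (simp add: sum_distrib_left mult_ac)
  finally show ?thesis .
qed

section \<open>Newton interpolation at 0, 1, ..., m\<close>

text \<open>Newton's forward difference formula: (-x)_k / k! is (-1)^k (x choose k), and the inner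
  sum is (-1)^k times the k-th difference of \<open>P\<close> at 0. Both sides have degree at most
  \<open>m\<close> and agree at the m + 1 points 0, ..., m by binomial inversion.\<close>

lemma newton_interpolation:
  fixes P :: "'a::field_char_0 poly"
  assumes "degree P \<le> m"
  shows "poly P x = (\<Sum>k\<le>m. pochhammer (- x) k / fact k *
    (\<Sum>i\<le>k. of_nat (k choose i) * (-1) ^ i * poly P (of_nat i)))"
proof -
  define D where "D k = (\<Sum>i\<le>k. of_nat (k choose i) * (-1) ^ i * poly P (of_nat i))" for k
  define Q where "Q = (\<Sum>k\<le>m. smult (D k / fact k) (pochhammer [:0, -1:] k))"
  have Q: "poly Q x = (\<Sum>k\<le>m. pochhammer (- x) k / fact k * D k)" for x
    by (simp add: Q_def poly_sum poly_pochhammer mult_ac)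
  have "degree (pochhammer [:0, -1 :: 'a:] k) \<le> k" for k
  proof (induction k)
    case (Suc k)
    have "degree ([:0, -1 :: 'a:] + of_nat k) \<le> 1"
      by (simp add: of_nat_poly)
    then show ?case
      using Suc degree_mult_le[of "pochhammer [:0, -1 :: 'a:] k" "[:0, -1:] + of_nat k"]
      by (simp add: pochhammer_Suc)
  qed simp
  then have dQ: "degree Q \<le> m"
    unfolding Q_def by (intro degree_sum_le) (auto intro: order_trans[OF degree_smult_le] order_trans)
  have "P = Q"
  proof (rule poly_eqI_degree[where A = "of_nat ` {..m}"])
    fix x :: 'a assume "x \<in> of_nat ` {..m}"
    then obtain n where n: "x = of_nat n" "n \<le> m" by auto
    have "poly Q x = (\<Sum>k\<le>n. pochhammer (- x) k / fact k * D k)"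
      unfolding Q by (rule sum.mono_neutral_right) (auto simp: n pochhammer_minus_of_nat binomial_eq_0)
    also have "\<dots> = (\<Sum>k\<le>n. \<Sum>i\<le>n. (-1) ^ i * poly P (of_nat i) *
        (of_nat (n choose k) * of_nat (k choose i) * (-1) ^ k))"
    proof (rule sum.cong[OF refl])
      fix k assume k: "k \<in> {..n}"
      have "D k = (\<Sum>i\<le>n. of_nat (k choose i) * (-1) ^ i * poly P (of_nat i))"
        unfolding D_def by (rule sum.mono_neutral_left) (use k in \<open>auto simp: binomial_eq_0\<close>)
      then show "pochhammer (- x) k / fact k * D k = (\<Sum>i\<le>n. (-1) ^ i * poly P (of_nat i) *
        (of_nat (n choose k) * of_nat (k choose i) * (-1) ^ k))"
        by (simp add: n pochhammer_minus_of_nat sum_distrib_left mult_ac)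
    qed
    also have "\<dots> = (\<Sum>i\<le>n. (-1) ^ i * poly P (of_nat i) *
        (\<Sum>k\<le>n. of_nat (n choose k) * of_nat (k choose i) * (-1) ^ k))"
      by (subst sum.swap) (simp add: sum_distrib_left)
    also have "\<dots> = (\<Sum>i\<le>n. if i = n then poly P (of_nat n) else 0)"
    proof (rule sum.cong[OF refl])
      fix i assume i: "i \<in> {..n}"
      \<comment> \<open>Orthogonality of binomial coefficients: the shifted alternating sum is (1 -
        1)^(n - i).\<close>
      have "(\<Sum>k\<le>n. of_nat (n choose k) * of_nat (k choose i) * (-1) ^ k) =
          of_nat (n choose i) * (-1) ^ i * (\<Sum>r\<le>n - i. (-1) ^ r * of_nat ((n - i) choose r) :: 'a)"
        unfolding sum_binomial_shift by (simp add: power_add sum_distrib_left mult_ac)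
      also have "\<dots> = (if i = n then (-1) ^ i else 0)"
        using i choose_alternating_sum[of "n - i", where ?'a = 'a] by auto
      finally have eq: "(\<Sum>k\<le>n. of_nat (n choose k) * of_nat (k choose i) * (-1) ^ k) =
          (if i = n then (-1) ^ i else (0::'a))" .
      show "(-1) ^ i * poly P (of_nat i) * (\<Sum>k\<le>n. of_nat (n choose k) * of_nat (k choose i) * (-1) ^ k) =
          (if i = n then poly P (of_nat n) else 0)"
        unfolding eq by (simp add: mult_ac)
    qed
    also have "\<dots> = poly P x"
      by (simp add: n)
    finally show "poly P x = poly Q x" ..
  qed (use dQ assms in \<open>simp_all add: card_image inj_on_def\<close>)
  then have "poly P x = poly Q x" by simp
  then show ?thesis
    by (simp add: Q D_def)
qed

section \<open>The polynomial \<open>Q_hat\<close>\<close>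

lemma pochhammer_nonzero: "z \<notin> \<int>\<^sub>\<le>\<^sub>0 \<Longrightarrow> pochhammer z n \<noteq> (0 :: 'a::field_char_0)"
  using pochhammer_eq_0_imp_nonpos_Int by blast

text \<open>Supplies the polynomial to which Newton interpolation and the growth bounds are
  applied.\<close>

lemma pochhammer_vec_shift_poly:
  obtains P where "degree P \<le> sum_list ps"
    "\<And>t. poly P t = pochhammer_vec (map (\<lambda>x. x + t) hs) ps"
proof -
  have deg: "degree (pochhammer [:x, 1 :: complex:] q) \<le> q" for x q
  proof (induction q)
    case (Suc q)
    have "degree ([:x, 1:] + of_nat q) \<le> 1"
      by (simp add: of_nat_poly)
    then show ?case
      using Suc degree_mult_le[of "pochhammer [:x, 1:] q" "[:x, 1:] + of_nat q"]
      by (simp add: pochhammer_Suc)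
  qed simp
  define P where "P = prod_list (map2 (\<lambda>x q. pochhammer [:x, 1 :: complex:] q) hs ps)"
  have "degree (prod_list (map2 (\<lambda>x q. pochhammer [:x, 1 :: complex:] q) hs ps)) \<le> sum_list ps"
  proof (induction ps arbitrary: hs)
    case (Cons q ps)
    show ?case
    proof (cases hs)
      case hs: (Cons x hs')
      show ?thesis
        using degree_mult_le[of "pochhammer [:x, 1:] q"] deg[of x q] Cons[of hs']
        by (fastforce simp: hs intro: order_trans)
    qed simp
  qed simp
  moreover have "poly P t = pochhammer_vec (map (\<lambda>x. x + t) hs) ps" for t
    unfolding P_def
  proof (induction ps arbitrary: hs)
    case (Cons q ps)
    then show ?case
      by (cases hs) (simp_all add: pochhammer_vec_def poly_pochhammer)
  qed (simp add: pochhammer_vec_def)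
  ultimately show ?thesis
    using that[of P] unfolding P_def by blast
qed

text \<open>Componentwise, (x)_q (x + q)_n and (x)_n (x + n)_q both equal (x)_(n + q). A quotient of
  symbols of length \<open>n\<close> thus becomes a polynomial in \<open>n\<close>.\<close>

lemma prod_list_pochhammer_ratio:
  assumes "length ps = length hs" "set hs \<inter> \<int>\<^sub>\<le>\<^sub>0 = {}"
  shows "(\<Prod>x\<leftarrow>map2 (\<lambda>x q. x + of_nat q) hs ps. pochhammer x n) / (\<Prod>x\<leftarrow>hs. pochhammer x n) =
    pochhammer_vec (map (\<lambda>x. x + of_nat n) hs) ps / pochhammer_vec hs ps"
  using assms
proof (induction ps hs rule: list_induct2)
  case (Cons q ps x hs)
  have "pochhammer x q * pochhammer (x + of_nat q) n = pochhammer x n * pochhammer (x + of_nat n) q"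
    by (metis add.commute pochhammer_product')
  moreover have "pochhammer x q \<noteq> 0" "pochhammer x n \<noteq> 0"
    using Cons.prems by (auto simp: pochhammer_nonzero)
  ultimately have ratio:
    "pochhammer (x + of_nat q) n / pochhammer x n = pochhammer (x + of_nat n) q / pochhammer x q"
    by (simp add: field_simps)
  have IH: "(\<Prod>x\<leftarrow>map2 (\<lambda>x q. x + of_nat q) hs ps. pochhammer x n) / (\<Prod>x\<leftarrow>hs. pochhammer x n) =
    pochhammer_vec (map (\<lambda>x. x + of_nat n) hs) ps / pochhammer_vec hs ps"
    using Cons.prems by (intro Cons.IH) auto
  show ?case
    using arg_cong2[OF ratio IH, of "(*)"]
    by (simp only: pochhammer_vec_def times_divide_times_eq list.map zip_Cons_Cons prod_list.Cons split_conv)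
qed (simp add: pochhammer_vec_def)

text \<open>Newton interpolation of \<open>G\<close>, the polynomial whose value at n is the
  left-hand side. Up to sign, its differences at 0 are the terminating series in the coefficients of
  \<open>Q_hat\<close>.\<close>

lemma pochhammer_ratio_expansion:
  fixes f :: "complex list"
  assumes "length ms = length f" and "set f \<inter> \<int>\<^sub>\<le>\<^sub>0 = {}"
  shows "(\<Prod>y\<leftarrow>map2 (\<lambda>x q. x + of_nat q) f ms. pochhammer y n) / (\<Prod>y\<leftarrow>f. pochhammer y n) =
    (\<Sum>k\<le>sum_list ms. (-1) ^ k * of_nat (n choose k) *
      hypergeom (- of_nat k # map2 (\<lambda>x q. x + of_nat q) f ms) f 1)"
proof -
  obtain P where P: "degree P \<le> sum_list ms"
    "\<And>t. poly P t = pochhammer_vec (map (\<lambda>x. x + t) f) ms"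
    using pochhammer_vec_shift_poly[where ps = ms and hs = f] by blast
  define G where "G = smult (1 / pochhammer_vec f ms) P"
  have G: "poly G (of_nat n) =
      (\<Prod>y\<leftarrow>map2 (\<lambda>x q. x + of_nat q) f ms. pochhammer y n) / (\<Prod>y\<leftarrow>f. pochhammer y n)" for n
    using prod_list_pochhammer_ratio[OF assms(1,2), of n] by (simp add: G_def P)
  have F: "hypergeom (- of_nat k # map2 (\<lambda>x q. x + of_nat q) f ms) f 1 =
      (\<Sum>i\<le>k. of_nat (k choose i) * (-1) ^ i * poly G (of_nat i))" for k
  proof -
    have "hypergeom (- of_nat k # map2 (\<lambda>x q. x + of_nat q) f ms) f 1 =
        (\<Sum>i\<le>k. hypergeom_term (- of_nat k # map2 (\<lambda>x q. x + of_nat q) f ms) f 1 1 i)"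
      by (rule hypergeom_terminating) simp
    also have "\<dots> = (\<Sum>i\<le>k. of_nat (k choose i) * (-1) ^ i * poly G (of_nat i))"
      by (intro sum.cong refl) (simp add: hypergeom_term_eq G pochhammer_minus_of_nat)
    finally show ?thesis .
  qed
  have "degree G \<le> sum_list ms"
    using P(1) degree_smult_le[of "1 / pochhammer_vec f ms" P] by (simp add: G_def)
  from newton_interpolation[OF this, of "of_nat n"] show ?thesis
    by (simp add: G F pochhammer_minus_of_nat)
qed

text \<open>Expand the quotient of the \<open>f\<close> parameters in binomials (n choose k). Each
  of them shifts a, b, c by k, so that \<open>euler_coeff\<close> applies to every summand; the
  finite sum it produces is the inner series of \<open>Q_hat\<close> at t = -N.\<close>

lemma Q_hat_coeff:
  fixes a b c :: complex and f :: "complex list" and ms :: "nat list"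
  defines "m \<equiv> sum_list ms"
  assumes len: "length ms = length f" and f: "set f \<inter> \<int>\<^sub>\<le>\<^sub>0 = {}" and c: "pochhammer c N \<noteq> 0"
    and A: "pochhammer (c - a - of_nat m) m \<noteq> 0" and B: "pochhammer (c - b - of_nat m) m \<noteq> 0"
  shows "(\<Sum>n\<le>N. of_nat (N choose n) * pochhammer (c - a - b - of_nat m) (N - n) *
      (pochhammer a n * pochhammer b n / pochhammer c n *
       ((\<Prod>y\<leftarrow>map2 (\<lambda>x q. x + of_nat q) f ms. pochhammer y n) / (\<Prod>y\<leftarrow>f. pochhammer y n)))) =
    pochhammer (c - a - of_nat m) N * pochhammer (c - b - of_nat m) N / pochhammer c N *
      Q_hat a b c f ms (- of_nat N)"
proof -
  define l where "l = c - a - b - of_nat m"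
  define A B where "A = c - a - of_nat m" and "B = c - b - of_nat m"
  define F where "F k = hypergeom (- of_nat k # map2 (\<lambda>x q. x + of_nat q) f ms) f 1" for k
  define H where "H k = hypergeom [- of_nat m + of_nat k, - of_nat N + of_nat k, l]
    [A + of_nat k, B + of_nat k] 1" for k
  define u where "u n = pochhammer a n * pochhammer b n / pochhammer c n" for n
  have AB: "pochhammer A k \<noteq> 0" "pochhammer (A + of_nat k) (m - k) \<noteq> 0"
    "pochhammer B k \<noteq> 0" "pochhammer (B + of_nat k) (m - k) \<noteq> 0" if "k \<le> m" for k
    using assms(5,6) pochhammer_product[OF that, of A] pochhammer_product[OF that, of B]
    unfolding A_def B_def by auto
  have inner: "(\<Sum>n\<le>N. of_nat (N choose n) * of_nat (n choose k) * (pochhammer l (N - n) * u n)) =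
    pochhammer A N * pochhammer B N / pochhammer c N *
      (pochhammer a k * pochhammer b k * of_nat (N choose k) / (pochhammer A k * pochhammer B k) * H k)"
    if k: "k \<le> m" for k
  proof (cases "k \<le> N")
    case True
    have split: "pochhammer z N = pochhammer z k * pochhammer (z + of_nat k) (N - k)" for z :: complex
      by (rule pochhammer_product[OF True])
    have "(\<Sum>n\<le>N. of_nat (N choose n) * of_nat (n choose k) * (pochhammer l (N - n) * u n)) =
        of_nat (N choose k) * u k * (\<Sum>r\<le>N - k. of_nat ((N - k) choose r) * pochhammer l (N - k - r) *
         (pochhammer (a + of_nat k) r * pochhammer (b + of_nat k) r / pochhammer (c + of_nat k) r))"
      unfolding sum_binomial_shift
      by (simp add: u_def pochhammer_product' sum_distrib_left mult_ac)
    \<comment> \<open>\<open>euler_coeff\<close> with a, b, c, A, B all raised by k and with M = m -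
      k; the exponent \<open>l\<close> stays the same.\<close>
    also have "(\<Sum>r\<le>N - k. of_nat ((N - k) choose r) * pochhammer l (N - k - r) *
         (pochhammer (a + of_nat k) r * pochhammer (b + of_nat k) r / pochhammer (c + of_nat k) r)) =
        pochhammer (A + of_nat k) (N - k) * pochhammer (B + of_nat k) (N - k) /
          pochhammer (c + of_nat k) (N - k) *
        (\<Sum>j\<le>m - k. of_nat ((m - k) choose j) * of_nat ((N - k) choose j) * fact j *
          pochhammer l j / (pochhammer (A + of_nat k) j * pochhammer (B + of_nat k) j))"
      using split[of c] c AB[OF k] k
      by (intro euler_coeff) (auto simp: A_def B_def l_def of_nat_diff)
    also have "(\<Sum>j\<le>m - k. of_nat ((m - k) choose j) * of_nat ((N - k) choose j) * fact j *
          pochhammer l j / (pochhammer (A + of_nat k) j * pochhammer (B + of_nat k) j)) = H k"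
    proof -
      have eqs: "- of_nat m + of_nat k = - (of_nat (m - k) :: complex)"
        "- of_nat N + of_nat k = - (of_nat (N - k) :: complex)"
        using k True by (simp_all add: of_nat_diff)
      have "H k = (\<Sum>j\<le>m - k. hypergeom_term [- of_nat (m - k), - of_nat (N - k), l]
          [A + of_nat k, B + of_nat k] 1 1 j)"
        unfolding H_def eqs by (rule hypergeom_terminating) simp
      also have "\<dots> = (\<Sum>j\<le>m - k. of_nat ((m - k) choose j) * of_nat ((N - k) choose j) * fact j *
          pochhammer l j / (pochhammer (A + of_nat k) j * pochhammer (B + of_nat k) j))"
        by (intro sum.cong refl) (simp add: hypergeom_term_eq pochhammer_minus_of_nat field_simps)
      finally show ?thesis ..
    qed
    finally show ?thesis
      using AB[OF k] by (simp only: split u_def) (simp add: field_simps)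
  qed (auto intro!: sum.neutral simp: binomial_eq_0)
  have "(\<Sum>n\<le>N. of_nat (N choose n) * pochhammer l (N - n) * (u n *
       ((\<Prod>y\<leftarrow>map2 (\<lambda>x q. x + of_nat q) f ms. pochhammer y n) / (\<Prod>y\<leftarrow>f. pochhammer y n)))) =
      (\<Sum>n\<le>N. \<Sum>k\<le>m. (-1) ^ k * F k *
        (of_nat (N choose n) * of_nat (n choose k) * (pochhammer l (N - n) * u n)))"
    unfolding pochhammer_ratio_expansion[OF len f] m_def F_def
    by (simp add: sum_distrib_left mult_ac)
  also have "\<dots> = (\<Sum>k\<le>m. (-1) ^ k * F k * (\<Sum>n\<le>N.
      of_nat (N choose n) * of_nat (n choose k) * (pochhammer l (N - n) * u n)))"
    by (subst sum.swap) (simp add: sum_distrib_left)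
  also have "\<dots> = (\<Sum>k\<le>m. pochhammer A N * pochhammer B N / pochhammer c N *
      (F k * pochhammer a k * pochhammer b k * pochhammer (- of_nat N) k /
        (pochhammer A k * pochhammer B k * fact k) * H k))"
  proof (rule sum.cong[OF refl])
    fix k assume "k \<in> {..m}"
    then have k: "k \<le> m" by simp
    show "(-1) ^ k * F k * (\<Sum>n\<le>N. of_nat (N choose n) * of_nat (n choose k) * (pochhammer l (N - n) * u n)) =
      pochhammer A N * pochhammer B N / pochhammer c N *
      (F k * pochhammer a k * pochhammer b k * pochhammer (- of_nat N) k /
        (pochhammer A k * pochhammer B k * fact k) * H k)"
      unfolding inner[OF k] by (simp add: pochhammer_minus_of_nat mult_ac)
  qed
  also have "\<dots> = pochhammer A N * pochhammer B N / pochhammer c N *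
      (\<Sum>k\<le>m. F k * pochhammer a k * pochhammer b k * pochhammer (- of_nat N) k /
        (pochhammer A k * pochhammer B k * fact k) * H k)"
    by (simp only: sum_distrib_left)
  also have "(\<Sum>k\<le>m. F k * pochhammer a k * pochhammer b k * pochhammer (- of_nat N) k /
        (pochhammer A k * pochhammer B k * fact k) * H k) = Q_hat a b c f ms (- of_nat N)"
    unfolding Q_hat_def Let_def m_def[symmetric] F_def H_def A_def B_def l_def by simp
  finally show ?thesis
    unfolding u_def l_def A_def B_def .
qed

text \<open>Since (z + 1)_n / (z)_n = (z + n) / z, the product over all zeros is Q(-n) / Q(0): the
  leading coefficient and the signs cancel.\<close>

lemma roots_pochhammer_ratio:
  fixes Q :: "complex poly"
  assumes roots: "mset zs = proots Q" and zs: "set zs \<inter> \<int>\<^sub>\<le>\<^sub>0 = {}" and Q0: "poly Q 0 = 1"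
  shows "(\<Prod>z\<leftarrow>map (\<lambda>z. z + 1) zs. pochhammer z n) / (\<Prod>z\<leftarrow>zs. pochhammer z n) = poly Q (- of_nat n)"
proof -
  have "Q = smult (lead_coeff Q) (\<Prod>x\<in>#proots Q. [:- x, 1:])"
    by (rule complex_poly_decompose_multiset[symmetric])
  also have "(\<Prod>x\<in>#proots Q. [:- x, 1:]) = (\<Prod>x\<leftarrow>zs. [:- x, 1:])"
    unfolding roots[symmetric] by (metis mset_map prod_mset_prod_list)
  finally have Q: "Q = smult (lead_coeff Q) (\<Prod>x\<leftarrow>zs. [:- x, 1:])" .
  have val: "poly Q t = lead_coeff Q * (\<Prod>x\<leftarrow>zs. t - x)" for t
  proof -
    have "poly (\<Prod>x\<leftarrow>zs. [:- x, 1:]) t = (\<Prod>x\<leftarrow>zs. t - x)"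
      by (induction zs) (simp_all add: algebra_simps)
    then show ?thesis
      by (subst Q) simp
  qed
  have "poly Q (- of_nat n) = (\<Prod>x\<leftarrow>zs. - of_nat n - x) / (\<Prod>x\<leftarrow>zs. 0 - x)"
  proof -
    have "lead_coeff Q * (\<Prod>x\<leftarrow>zs. 0 - x) = 1"
      using val[of 0] Q0 by simp
    then have "lead_coeff Q = 1 / (\<Prod>x\<leftarrow>zs. 0 - x)"
      by (metis eq_divide_imp mult_zero_right zero_neq_one)
    then show ?thesis
      by (simp only: val[of "- of_nat n"]) simp
  qed
  also have "\<dots> = (\<Prod>z\<leftarrow>map (\<lambda>z. z + 1) zs. pochhammer z n) / (\<Prod>z\<leftarrow>zs. pochhammer z n)"
    using zs
  proof (induction zs)
    case (Cons z zs)
    have z: "z \<noteq> 0" "pochhammer z n \<noteq> 0"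
      using Cons.prems by (auto simp: pochhammer_nonzero)
    have "z * pochhammer (z + 1) n = pochhammer z n * (z + of_nat n)"
      by (metis pochhammer_Suc pochhammer_rec)
    then have ratio: "(- of_nat n - z) / (0 - z) = pochhammer (z + 1) n / pochhammer z n"
      using z by (simp add: field_simps)
    have IH: "(\<Prod>x\<leftarrow>zs. - of_nat n - x) / (\<Prod>x\<leftarrow>zs. 0 - x) =
        (\<Prod>z\<leftarrow>map (\<lambda>z. z + 1) zs. pochhammer z n) / (\<Prod>z\<leftarrow>zs. pochhammer z n)"
      using Cons.prems by (intro Cons.IH) auto
    show ?case
      using arg_cong2[OF ratio IH, of "(*)"]
      by (simp only: times_divide_times_eq list.map prod_list.Cons)
  qed simp
  finally show ?thesis ..
qed

section \<open>Gauss's summation theorem\<close>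

lemma not_nonpos_Int_plus_of_nat:
  fixes z :: "'a::ring_char_0"
  assumes "z \<notin> \<int>\<^sub>\<le>\<^sub>0"
  shows "z + of_nat n \<notin> \<int>\<^sub>\<le>\<^sub>0"
proof (induction n)
  case (Suc n)
  then show ?case
    using plus_one_in_nonpos_Ints_imp[of "z + of_nat n"] by (auto simp: add_ac)
qed (use assms in simp)

section \<open>Growth of Pochhammer quotients\<close>

lemma Re_pos_imp_not_nonpos_Int: "Re z > 0 \<Longrightarrow> z \<notin> \<int>\<^sub>\<le>\<^sub>0"
  by (auto elim!: nonpos_Ints_cases)

text \<open>Absorbs an index shift into a constant, for either sign of the exponent.\<close>

lemma powr_shift_le:
  assumes "n > 0"
  shows "(real n + 2) powr s \<le> 3 powr \<bar>s\<bar> * real n powr s"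
proof (cases "s \<ge> 0")
  case True
  have "(real n + 2) powr s \<le> (3 * real n) powr s"
    using True assms by (intro powr_mono2) auto
  then show ?thesis
    using True by (simp add: powr_mult)
next
  case False
  have "(real n + 2) powr s \<le> 1 * real n powr s"
    using False assms by (simp add: powr_mono2')
  also have "\<dots> \<le> 3 powr \<bar>s\<bar> * real n powr s"
    using ge_one_powr_ge_zero[of 3 "\<bar>s\<bar>"] by (intro mult_right_mono) auto
  finally show ?thesis .
qed

text \<open>The product of the limit sequences for 1 / Gamma(z) and Gamma(w) is (z)_(n+1) /
  (w)_(n+1) times n^(w - z); it converges, hence is bounded. Taking the reciprocal Gamma function at
  \<open>z\<close> keeps non-positive integers \<open>z\<close> admissible, and the base n + 1 makes
  the bound meaningful at n = 0.\<close>

lemma pochhammer_ratio_bound: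
  fixes z w :: complex
  assumes w: "w \<notin> \<int>\<^sub>\<le>\<^sub>0"
  obtains C where "C \<ge> 0"
    "\<And>n. norm (pochhammer z n / pochhammer w n) \<le> C * (real n + 1) powr (Re z - Re w)"
proof -
  define s where "s = Re z - Re w"
  define X where "X n = rGamma_series z n * Gamma_series w n" for n
  define Y where "Y n = norm (pochhammer z n / pochhammer w n) * (real n + 1) powr (- s)" for n
  have "X \<longlonglongrightarrow> rGamma z * Gamma w"
    unfolding X_def by (intro tendsto_intros)
  then have "(\<lambda>n. 3 powr \<bar>s\<bar> * norm (X n)) \<longlonglongrightarrow> 3 powr \<bar>s\<bar> * norm (rGamma z * Gamma w)"
    by (intro tendsto_intros)
  then have B: "Bseq (\<lambda>n. 3 powr \<bar>s\<bar> * norm (X n))"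
    by (intro convergent_imp_Bseq convergentI)
  have "Bseq (\<lambda>n. Y (Suc n))"
  proof (rule Bseq_eventually_mono[OF _ B])
    show "\<forall>\<^sub>F n in sequentially. norm (Y (Suc n)) \<le> norm (3 powr \<bar>s\<bar> * norm (X n))"
      using eventually_gt_at_top[of 0]
    proof eventually_elim
      case (elim n)
      have "norm (X n) = norm (pochhammer z (Suc n) / pochhammer w (Suc n)) * real n powr (- s)"
      proof -
        have "X n = pochhammer z (Suc n) / pochhammer w (Suc n) *
            exp ((w - z) * of_real (ln (of_nat n)))"
          by (simp add: X_def rGamma_series_def Gamma_series_def exp_diff left_diff_distrib)
        moreover have "norm (exp ((w - z) * of_real (ln (of_nat n)))) = real n powr (- s)"
          using elim by (simp add: powr_def s_def)
        ultimately show ?thesis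
          by (simp only: norm_mult)
      qed
      moreover have "norm (pochhammer z (Suc n) / pochhammer w (Suc n)) * (real n + 2) powr (- s) \<le>
          norm (pochhammer z (Suc n) / pochhammer w (Suc n)) * (3 powr \<bar>- s\<bar> * real n powr (- s))"
        using powr_shift_le[OF elim, of "- s"] by (intro mult_left_mono) auto
      ultimately show ?case
        by (simp add: Y_def mult_ac add_ac)
    qed
  qed
  then have "Bseq Y"
    by (simp add: Bseq_Suc_iff)
  then obtain K where K: "K > 0" "\<And>n. norm (Y n) \<le> K"
    unfolding Bseq_def by blast
  have "norm (pochhammer z n / pochhammer w n) \<le> K * (real n + 1) powr (Re z - Re w)" for n
    using K(2)[of n] unfolding Y_def s_def[symmetric]
    by (simp add: powr_minus field_simps)
  then show ?thesis
    using that[of K] K(1) by simp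
qed

lemma summable_powr_shift:
  "s < -1 \<Longrightarrow> summable (\<lambda>n. (real n + 1) powr s)"
  using summable_Suc_iff[of "\<lambda>n. real n powr s"] summable_real_powr_iff[of s] by (simp add: add_ac)

section \<open>Convergence and value of F(a, b; c; 1)\<close>

definition gauss_term :: "complex \<Rightarrow> complex \<Rightarrow> complex \<Rightarrow> nat \<Rightarrow> complex" where
  "gauss_term a b c n = pochhammer a n * pochhammer b n / (pochhammer c n * fact n)"

lemma gauss_term_bound:
  assumes "c \<notin> \<int>\<^sub>\<le>\<^sub>0"
  obtains C where "C \<ge> 0"
    "\<And>n. norm (gauss_term a b c n) \<le> C * (real n + 1) powr (Re (a + b - c) - 1)"
proof -
  obtain C1 where C1: "C1 \<ge> 0"
    "\<And>n. norm (pochhammer a n / pochhammer c n) \<le> C1 * (real n + 1) powr (Re a - Re c)"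
    using pochhammer_ratio_bound[OF assms] by blast
  have "(1::complex) \<notin> \<int>\<^sub>\<le>\<^sub>0" by simp
  then obtain C2 where C2: "C2 \<ge> 0"
    "\<And>n. norm (pochhammer b n / pochhammer 1 n) \<le> C2 * (real n + 1) powr (Re b - Re 1)"
    using pochhammer_ratio_bound by blast
  have "norm (gauss_term a b c n) \<le> C1 * C2 * (real n + 1) powr (Re (a + b - c) - 1)" for n
  proof -
    have "norm (gauss_term a b c n) =
        norm (pochhammer a n / pochhammer c n) * norm (pochhammer b n / pochhammer 1 n)"
      by (simp add: gauss_term_def norm_mult norm_divide pochhammer_fact)
    also have "\<dots> \<le> (C1 * (real n + 1) powr (Re a - Re c)) * (C2 * (real n + 1) powr (Re b - Re 1))"
      by (intro mult_mono C1 C2) (use C1 C2 in auto)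
    also have "\<dots> = C1 * C2 * ((real n + 1) powr (Re a - Re c) * (real n + 1) powr (Re b - Re 1))"
      by simp
    also have "\<dots> = C1 * C2 * (real n + 1) powr (Re (a + b - c) - 1)"
      unfolding powr_add[symmetric] by (simp add: algebra_simps)
    finally show ?thesis .
  qed
  then show ?thesis
    using that[of "C1 * C2"] C1 C2 by simp
qed

lemma gauss_summable:
  assumes "c \<notin> \<int>\<^sub>\<le>\<^sub>0" "Re (c - a - b) > 0"
  shows "summable (\<lambda>n. norm (gauss_term a b c n))"
proof -
  obtain C where C: "C \<ge> 0"
    "\<And>n. norm (gauss_term a b c n) \<le> C * (real n + 1) powr (Re (a + b - c) - 1)"
    using gauss_term_bound[OF assms(1)] by blast
  have "summable (\<lambda>n. C * (real n + 1) powr (Re (a + b - c) - 1))"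
    using assms(2) by (intro summable_mult summable_powr_shift) simp
  then show ?thesis
    by (rule summable_comparison_test[rotated]) (use C in auto)
qed

text \<open>The termwise difference of the two sides telescopes: it is -c times the increment of U n
  = n * \<open>gauss_term a b c n\<close>. Here U 0 = 0, and U tends to 0 because its growth
  exponent Re(a + b - c) is negative.\<close>

lemma gauss_contiguous:
  assumes c: "c \<notin> \<int>\<^sub>\<le>\<^sub>0" and re: "Re (c - a - b) > 0"
  shows "c * (c - a - b) * (\<Sum>n. gauss_term a b c n) =
    (c - a) * (c - b) * (\<Sum>n. gauss_term a b (c + 1) n)"
proof -
  have c1: "c + 1 \<notin> \<int>\<^sub>\<le>\<^sub>0"
    using c plus_one_in_nonpos_Ints_imp by blast
  define U where "U n = of_nat n * gauss_term a b c n" for n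
  have cn: "c + of_nat n \<noteq> 0" for n
    using c plus_of_nat_eq_0_imp by blast
  have step: "c * (c - a - b) * gauss_term a b c n - (c - a) * (c - b) * gauss_term a b (c + 1) n =
      - c * (U (Suc n) - U n)" for n
  proof -
    have t1: "gauss_term a b (c + 1) n = gauss_term a b c n * c / (c + of_nat n)"
    proof -
      have "c * pochhammer (c + 1) n = pochhammer c n * (c + of_nat n)"
        by (metis pochhammer_Suc pochhammer_rec)
      then have "pochhammer (c + 1) n = pochhammer c n * (c + of_nat n) / c"
        using cn[of 0] by (simp add: field_simps)
      then show ?thesis
        by (simp add: gauss_term_def mult_ac)
    qed
    have t2: "U (Suc n) = gauss_term a b c n * (a + of_nat n) * (b + of_nat n) / (c + of_nat n)"
    proof -
      have "of_nat (Suc n) \<noteq> (0::complex)" by (simp only: of_nat_eq_0_iff)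
      then show ?thesis
        by (simp add: U_def gauss_term_def pochhammer_Suc mult_ac del: of_nat_Suc)
    qed
    show ?thesis
      unfolding t1 t2 unfolding U_def using cn[of n] by (simp add: field_simps)
  qed
  have "U \<longlonglongrightarrow> 0"
  proof -
    obtain C where C: "C \<ge> 0"
      "\<And>n. norm (gauss_term a b c n) \<le> C * (real n + 1) powr (Re (a + b - c) - 1)"
      using gauss_term_bound[OF c] by blast
    have bound: "norm (U n) \<le> C * (real n + 1) powr (Re (a + b - c))" for n
    proof -
      have "norm (U n) \<le> (real n + 1) * (C * (real n + 1) powr (Re (a + b - c) - 1))"
        unfolding U_def norm_mult by (intro mult_mono C) auto
      also have "\<dots> = C * ((real n + 1) powr 1 * (real n + 1) powr (Re (a + b - c) - 1))"
        by simp
      also have "\<dots> = C * (real n + 1) powr (Re (a + b - c))"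
        unfolding powr_add[symmetric] by (simp add: algebra_simps)
      finally show ?thesis .
    qed
    have lim: "(\<lambda>n. C * (real n + 1) powr (Re (a + b - c))) \<longlonglongrightarrow> 0"
    proof -
      have "filterlim (\<lambda>n. real n + 1) at_top sequentially"
        using filterlim_compose[OF filterlim_real_sequentially filterlim_Suc] by (simp add: add_ac)
      then have "(\<lambda>n. (real n + 1) powr (Re (a + b - c))) \<longlonglongrightarrow> 0"
        using re by (intro tendsto_neg_powr) auto
      then show ?thesis
        using tendsto_mult_right_zero by blast
    qed
    show ?thesis
      by (rule Lim_null_comparison[OF always_eventually lim]) (use bound in auto)
  qed
  then have "(\<lambda>n. U (Suc n) - U n) sums (0 - U 0)"
    by (rule telescope_sums)
  then have "(\<lambda>n. - c * (U (Suc n) - U n)) sums 0"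
    using sums_mult[of _ 0 "- c"] by (simp add: U_def)
  moreover have "(\<lambda>n. c * (c - a - b) * gauss_term a b c n - (c - a) * (c - b) * gauss_term a b (c + 1) n)
      sums (c * (c - a - b) * (\<Sum>n. gauss_term a b c n) - (c - a) * (c - b) * (\<Sum>n. gauss_term a b (c + 1) n))"
    using re by (intro sums_diff sums_mult summable_sums summable_norm_cancel[OF gauss_summable] c c1) auto
  ultimately show ?thesis
    unfolding step using sums_unique2 by force
qed

text \<open>Every term except the one at k = 0, which is 1, tends to 0 as the lower parameter grows;
  Tannery's theorem passes to the sum.\<close>

lemma gauss_tendsto_1: "(\<lambda>n. \<Sum>k. gauss_term a b (c + of_nat n) k) \<longlonglongrightarrow> 1"
proof -
  \<comment> \<open>This choice gives Re(R - a - b) > 0, so the Gauss series with lower parameter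
    \<open>R\<close> converges absolutely. It is the majorant as soon as Re c + n >= R.\<close>
  define R where "R = norm a + norm b + 1"
  have R: "R > 0"
    by (simp add: R_def add_nonneg_pos)
  have R': "complex_of_real R \<notin> \<int>\<^sub>\<le>\<^sub>0"
    using R by (intro Re_pos_imp_not_nonpos_Int) simp
  define M where "M k = norm (gauss_term a b (of_real R) k)" for k
  have "Re (of_real R - a - b) > 0"
    using complex_Re_le_cmod[of a] complex_Re_le_cmod[of b] by (simp add: R_def)
  then have M: "summable M"
    unfolding M_def by (intro gauss_summable R')
  have inv: "(\<lambda>n. inverse (pochhammer (c + of_nat n) k)) \<longlonglongrightarrow> (if k = 0 then 1 else 0)" for k
  proof (induction k)
    case (Suc k)
    have "filterlim (\<lambda>n. (c + of_nat k) + of_nat n) at_infinity sequentially"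
      by (intro tendsto_add_filterlim_at_infinity[OF tendsto_const] tendsto_of_nat)
    then have "(\<lambda>n. inverse (c + of_nat k + of_nat n)) \<longlonglongrightarrow> 0"
      by (rule filterlim_compose[OF tendsto_inverse_0])
    from tendsto_mult[OF Suc this] show ?case
      by (simp add: pochhammer_Suc add_ac mult_ac)
  qed simp
  have lim: "(\<lambda>n. gauss_term a b (c + of_nat n) k) \<longlonglongrightarrow> (if k = 0 then 1 else 0)" for k
    using tendsto_mult[OF tendsto_const[of "pochhammer a k * pochhammer b k / fact k"] inv[of k]]
    by (cases "k = 0") (simp_all add: gauss_term_def field_simps)
  obtain N where N: "real N \<ge> R - Re c"
    using real_arch_simple by blast
  have low: "pochhammer R k \<le> norm (pochhammer (c + of_nat n) k)" if "n \<ge> N" for k n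
  proof (induction k)
    case (Suc k)
    have "R + real k \<le> Re (c + of_nat n + of_nat k)"
      using N that by simp
    also have "\<dots> \<le> norm (c + of_nat n + of_nat k)"
      by (rule complex_Re_le_cmod)
    finally show ?case
      unfolding pochhammer_Suc norm_mult using Suc R by (intro mult_mono) auto
  qed simp
  have "norm (gauss_term a b (c + of_nat n) k) \<le> M k" if "n \<ge> N" for k n
  proof -
    have "norm (pochhammer (complex_of_real R) k) = pochhammer R k"
      using pochhammer_pos[OF R, of k] by (simp add: pochhammer_of_real)
    then show ?thesis
      using low[OF that, of k] pochhammer_pos[OF R, of k]
      unfolding M_def gauss_term_def norm_mult norm_divide
      by (intro divide_left_mono mult_right_mono mult_nonneg_nonneg mult_pos_pos) auto
  qed
  then have "eventually (\<lambda>n. \<forall>k. norm (gauss_term a b (c + of_nat n) k) \<le> M k) sequentially"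
    unfolding eventually_sequentially by blast
  \<comment> \<open>Tannery's theorem takes the domination along a product filter; here it holds for
    all k at once.\<close>
  from eventually_prodI[OF always_eventually[of "\<lambda>_. True"] this, of at_top]
  have "\<forall>\<^sub>F (k, n) in at_top \<times>\<^sub>F sequentially. norm (gauss_term a b (c + of_nat n) k) \<le> M k"
    by (rule eventually_mono) auto
  from tannerys_theorem[OF lim this M] 
  have "(\<lambda>n. \<Sum>k. gauss_term a b (c + of_nat n) k) \<longlonglongrightarrow> (\<Sum>k. if k = 0 then 1 else 0)"
    by simp
  also have "(\<Sum>k::nat. if k = 0 then 1 else 0) = (1::complex)"
    using sums_single[of 0 "\<lambda>_. 1::complex"] by (simp add: sums_iff)
  finally show ?thesis .
qed

text \<open>Iterating the contiguous relation expresses F(c) through F(c + n), and F(c + n) tends to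
  1. Reciprocal Gamma factors cover the cases where c - a or c - b is a non-positive
  integer.\<close>

theorem gauss_summation:
  assumes c: "c \<notin> \<int>\<^sub>\<le>\<^sub>0" and re: "Re (c - a - b) > 0"
  shows "gauss_term a b c sums (Gamma c * Gamma (c - a - b) * rGamma (c - a) * rGamma (c - b))"
proof -
  define F where "F c = (\<Sum>n. gauss_term a b c n)" for c
  define s where "s = c - a - b"
  have s: "s \<notin> \<int>\<^sub>\<le>\<^sub>0"
    using re by (intro Re_pos_imp_not_nonpos_Int) (simp add: s_def)
  have iter: "pochhammer c n * pochhammer s n * F c =
      pochhammer (c - a) n * pochhammer (c - b) n * F (c + of_nat n)" for n
  proof (induction n)
    case (Suc n)
    have cn: "c + of_nat n \<notin> \<int>\<^sub>\<le>\<^sub>0"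
      using c by (rule not_nonpos_Int_plus_of_nat)
    have "(c + of_nat n) * (s + of_nat n) * F (c + of_nat n) =
        (c - a + of_nat n) * (c - b + of_nat n) * F (c + of_nat (Suc n))"
      using gauss_contiguous[OF cn, of a b] re by (simp add: F_def s_def algebra_simps)
    note step = this
    have "pochhammer c (Suc n) * pochhammer s (Suc n) * F c =
        (c + of_nat n) * (s + of_nat n) * (pochhammer c n * pochhammer s n * F c)"
      by (simp add: pochhammer_Suc mult_ac)
    also have "\<dots> = pochhammer (c - a) n * pochhammer (c - b) n *
        ((c + of_nat n) * (s + of_nat n) * F (c + of_nat n))"
      unfolding Suc by (simp only: mult_ac)
    also have "\<dots> = pochhammer (c - a) (Suc n) * pochhammer (c - b) (Suc n) * F (c + of_nat (Suc n))"
      unfolding step by (simp only: pochhammer_Suc mult_ac)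
    finally show ?case .
  qed simp
  \<comment> \<open>The powers of n in the four factors cancel because c + s = (c - a) + (c - b).
    What remains is the exact Pochhammer quotient of length n + 1, which is why F is taken at c + n
    + 1.\<close>
  define L where "L n = rGamma_series (c - a) n * rGamma_series (c - b) n *
      Gamma_series c n * Gamma_series s n" for n
  have "(\<lambda>n. L n * F (c + of_nat (Suc n))) \<longlonglongrightarrow>
      (rGamma (c - a) * rGamma (c - b) * Gamma c * Gamma s) * 1"
    unfolding L_def F_def
    by (intro tendsto_intros LIMSEQ_Suc[OF gauss_tendsto_1])
  moreover have "\<forall>\<^sub>F n in sequentially. L n * F (c + of_nat (Suc n)) = F c"
    using eventually_gt_at_top[of 0]
  proof eventually_elim
    case (elim n)
    define E where "E z = exp (z * of_real (ln (of_nat n)) :: complex)" for z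
    have E: "E c * E s = E (c - a) * E (c - b)"
      unfolding E_def by (simp add: s_def algebra_simps flip: exp_add)
    have Enz: "E z \<noteq> 0" for z by (simp add: E_def)
    have "L n = pochhammer (c - a) (Suc n) * pochhammer (c - b) (Suc n) /
        (pochhammer c (Suc n) * pochhammer s (Suc n)) * ((E c * E s) / (E (c - a) * E (c - b)))"
      by (simp add: L_def rGamma_series_def Gamma_series_def E_def[symmetric] mult_ac)
    also have "\<dots> = pochhammer (c - a) (Suc n) * pochhammer (c - b) (Suc n) /
        (pochhammer c (Suc n) * pochhammer s (Suc n))"
      unfolding E using Enz by simp
    finally have L: "L n = pochhammer (c - a) (Suc n) * pochhammer (c - b) (Suc n) /
        (pochhammer c (Suc n) * pochhammer s (Suc n))" .
    show ?case
      unfolding L using iter[of "Suc n"] pochhammer_nonzero[OF c, of "Suc n"] pochhammer_nonzero[OF s, of "Suc n"]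
      by (simp add: field_simps)
  qed
  ultimately have "(\<lambda>_::nat. F c) \<longlonglongrightarrow> (rGamma (c - a) * rGamma (c - b) * Gamma c * Gamma s) * 1"
    using tendsto_cong by fast
  then have "F c = rGamma (c - a) * rGamma (c - b) * Gamma c * Gamma s"
    using LIMSEQ_const_iff by fastforce
  moreover have "gauss_term a b c sums F c"
    unfolding F_def by (intro summable_sums summable_norm_cancel[OF gauss_summable] assms)
  ultimately show ?thesis
    by (simp add: s_def mult_ac)
qed

section \<open>Summation of Euler-transformed series\<close>

text \<open>Fubini: a product of two summable powers dominates the double series, so that row sums
  and diagonal sums have the same total.\<close>

lemma sums_diagonal_rearrange:
  fixes G :: "nat \<Rightarrow> nat \<Rightarrow> complex"
  assumes bound: "\<And>k j. norm (G k j) \<le> K * (real k + 1) powr x * (real j + 1) powr y"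
    and xy: "x < -1" "y < -1"
    and rows: "\<And>k. G k sums r k"
  shows "summable r" "(\<lambda>n. \<Sum>k\<le>n. G k (n - k)) sums (\<Sum>k. r k)"
proof -
  define g where "g = (\<lambda>(k, j). K * (real k + 1) powr x * (real j + 1) powr y)"
  have "0 \<le> K"
    using order_trans[OF norm_ge_zero bound[of 0 0]] by simp
  define S where "S = (\<Sum>j. (real j + 1) powr y)"
  have "(\<lambda>j. (real j + 1) powr y) sums S"
    unfolding S_def using summable_powr_shift[OF xy(2)] by (rule summable_sums)
  then have grow: "((\<lambda>j. g (k, j)) has_sum K * (real k + 1) powr x * S) UNIV" for k
    unfolding g_def prod.case using \<open>0 \<le> K\<close> by (intro sums_nonneg_imp_has_sum sums_mult) auto
  have "0 \<le> S"
    unfolding S_def by (intro suminf_nonneg summable_powr_shift xy) auto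
  then have "(\<lambda>k. K * (real k + 1) powr x * S) summable_on UNIV"
    using \<open>0 \<le> K\<close> by (intro summable_nonneg_imp_summable_on summable_mult summable_mult2
        summable_powr_shift xy) auto
  with grow have "g summable_on UNIV \<times> UNIV"
    by (rule summable_on_SigmaI) (use \<open>0 \<le> K\<close> in \<open>auto simp: g_def\<close>)
  then have "(\<lambda>z. norm (case z of (k, j) \<Rightarrow> G k j)) summable_on UNIV \<times> UNIV"
    by (rule Infinite_Sum.abs_summable_on_comparison_test') (auto simp: g_def bound)
  then have "(\<lambda>(k, j). G k j) summable_on UNIV \<times> UNIV"
    by (rule abs_summable_summable)
  then obtain T where T: "((\<lambda>(k, j). G k j) has_sum T) (UNIV \<times> UNIV)"
    by (auto simp: summable_on_def)
  have "(G k has_sum r k) UNIV" for k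
  proof (rule norm_summable_imp_has_sum[OF _ rows])
    have "summable (\<lambda>j. g (k, j))"
      using has_sum_imp_sums[OF grow] by (auto simp: sums_iff)
    then show "summable (\<lambda>j. norm (G k j))"
      by (rule summable_comparison_test[rotated]) (auto simp: g_def bound)
  qed
  then have "(r has_sum T) UNIV"
    by (intro has_sum_SigmaD[OF T]) auto
  then have r: "r sums T"
    by (rule has_sum_imp_sums)
  then show "summable r"
    by (auto simp: sums_iff)
  \<comment> \<open>Reindexing of the quadrant by the diagonals n = k + j.\<close>
  have "((\<lambda>(n, k). G k (n - k)) has_sum T) (Sigma UNIV (\<lambda>n. {..n}))"
    using T by (subst has_sum_reindex_bij_witness[of _ "\<lambda>(k, j). (k + j, k)" "\<lambda>(n, k). (k, n - k)"
          "UNIV \<times> UNIV" "\<lambda>(k, j). G k j" _ _ T]) auto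
  then have "((\<lambda>n. \<Sum>k\<le>n. G k (n - k)) has_sum T) UNIV"
    by (rule has_sum_SigmaD) (auto intro!: has_sum_finiteI)
  then show "(\<lambda>n. \<Sum>k\<le>n. G k (n - k)) sums (\<Sum>k. r k)"
    using r has_sum_imp_sums sums_unique by metis
qed

text \<open>Distributes the decay in k + j over the two indices, in shares that can be chosen
  freely.\<close>

lemma powr_split_le:
  fixes d1 d2 :: real
  assumes "0 \<le> d1" "0 \<le> d2"
  shows "(real (k + j) + 1) powr (- (d1 + d2)) \<le> (real k + 1) powr (- d1) * (real j + 1) powr (- d2)"
proof -
  have "(real (k + j) + 1) powr (- (d1 + d2)) = (real (k + j) + 1) powr (- d1) * (real (k + j) + 1) powr (- d2)"
    by (simp flip: powr_add)
  also have "\<dots> \<le> (real k + 1) powr (- d1) * (real j + 1) powr (- d2)"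
    using assms by (intro mult_mono powr_mono2') auto
  finally show ?thesis .
qed

text \<open>Inserting the convolution for \<open>u\<close> gives a double series. Its k-th row is
  v_k (d)_k / (e)_k times the Gauss series with parameters d + k, -l; e + k, whose value is the same
  constant \<open>C\<close> for all rows times a ratio that changes (e)_k into (e + l)_k.\<close>

lemma euler_transform_sums_aux:
  fixes u v :: "nat \<Rightarrow> complex"
  assumes e: "e \<notin> \<int>\<^sub>\<le>\<^sub>0" and el: "e + l \<notin> \<int>\<^sub>\<le>\<^sub>0"
    and conv: "\<And>n. u n = (\<Sum>k\<le>n. v k * (pochhammer (- l) (n - k) / fact (n - k)))"
    and v: "\<And>n. norm (v n) \<le> K * (real n + 1) powr (Re l - 1)"
    and re: "\<bar>Re l\<bar> < Re (e - d)"
  shows "summable (\<lambda>n. v n * (pochhammer d n / pochhammer (e + l) n))"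
    "(\<lambda>n. u n * (pochhammer d n / pochhammer e n)) sums
       (Gamma e * Gamma (e - d + l) / (Gamma (e - d) * Gamma (e + l)) *
        (\<Sum>n. v n * (pochhammer d n / pochhammer (e + l) n)))"
proof -
  define C where "C = Gamma e * Gamma (e - d + l) / (Gamma (e - d) * Gamma (e + l))"
  define G where "G k j = v k * (pochhammer (- l) j / fact j) *
      (pochhammer d (k + j) / pochhammer e (k + j))" for k j
  define w where "w n = v n * (pochhammer d n / pochhammer (e + l) n)" for n
  have pos: "Re (e - d) > 0" "Re (e - d + l) > 0"
    using re by auto
  have "C \<noteq> 0"
    using e el pos[THEN Re_pos_imp_not_nonpos_Int] by (simp add: C_def Gamma_eq_zero_iff)
  have rows: "G k sums (C * w k)" for k
  proof -
    have ek: "e + of_nat k \<notin> \<int>\<^sub>\<le>\<^sub>0"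
      using e by (rule not_nonpos_Int_plus_of_nat)
    have G: "G k = (\<lambda>j. v k * (pochhammer d k / pochhammer e k) *
        gauss_term (d + of_nat k) (- l) (e + of_nat k) j)"
      by (rule ext) (simp add: G_def gauss_term_def pochhammer_product' mult_ac)
    have "gauss_term (d + of_nat k) (- l) (e + of_nat k) sums
        (Gamma (e + of_nat k) * Gamma (e - d + l) * rGamma (e - d) * rGamma (e + l + of_nat k))"
      using gauss_summation[OF ek, of "d + of_nat k" "- l"] pos by (simp add: add_ac)
    then have "G k sums (v k * (pochhammer d k / pochhammer e k) *
        (Gamma (e + of_nat k) * Gamma (e - d + l) * rGamma (e - d) * rGamma (e + l + of_nat k)))"
      unfolding G by (rule sums_mult)
    also have "Gamma (e + of_nat k) = pochhammer e k * Gamma e"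
      using e by (simp add: pochhammer_Gamma Gamma_eq_zero_iff)
    also have "rGamma (e + l + of_nat k) = 1 / (pochhammer (e + l) k * Gamma (e + l))"
      using el by (simp add: pochhammer_Gamma Gamma_eq_zero_iff rGamma_inverse_Gamma field_simps)
    also have "v k * (pochhammer d k / pochhammer e k) *
        (pochhammer e k * Gamma e * Gamma (e - d + l) * rGamma (e - d) *
          (1 / (pochhammer (e + l) k * Gamma (e + l)))) = C * w k"
      using pochhammer_nonzero[OF e, of k]
      by (simp add: C_def w_def rGamma_inverse_Gamma field_simps)
    finally show ?thesis .
  qed
  \<comment> \<open>The decay exponent Re(e - d) is split as d1 + d2. Rows and columns are both
    summable when d1 > Re l and d2 > -Re l, and \<open>powr_split_le\<close> wants both shares
    nonnegative; the bound on |Re l| leaves room for such a \<open>d1\<close>.\<close>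
  have "max (Re l) 0 < min (Re (e - d)) (Re (e - d) + Re l)"
    using re by auto
  from dense[OF this] obtain d1
    where d1: "max (Re l) 0 < d1" "d1 < min (Re (e - d)) (Re (e - d) + Re l)"
    by blast
  define d2 where "d2 = Re (e - d) - d1"
  obtain C1 where C1: "C1 \<ge> 0"
    "\<And>n. norm (pochhammer (- l) n / pochhammer 1 n) \<le> C1 * (real n + 1) powr (Re (- l) - Re 1)"
    using pochhammer_ratio_bound[of 1 "- l"] by auto
  obtain C2 where C2: "C2 \<ge> 0"
    "\<And>n. norm (pochhammer d n / pochhammer e n) \<le> C2 * (real n + 1) powr (Re d - Re e)"
    using pochhammer_ratio_bound[OF e] by blast
  have "K \<ge> 0"
    using order_trans[OF norm_ge_zero v[of 0]] by simp
  have bound: "norm (G k j) \<le> K * C1 * C2 * (real k + 1) powr (Re l - 1 - d1) *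
      (real j + 1) powr (- Re l - 1 - d2)" for k j
  proof -
    have "norm (pochhammer d (k + j) / pochhammer e (k + j)) \<le>
        C2 * (real (k + j) + 1) powr (- (d1 + d2))"
      using C2(2)[of "k + j"] by (simp add: d2_def)
    also have "\<dots> \<le> C2 * ((real k + 1) powr (- d1) * (real j + 1) powr (- d2))"
      using d1 C2(1) by (intro mult_left_mono powr_split_le) (auto simp: d2_def)
    finally have de: "norm (pochhammer d (k + j) / pochhammer e (k + j)) \<le>
      C2 * ((real k + 1) powr (- d1) * (real j + 1) powr (- d2))" .
    have l: "norm (pochhammer (- l) j / fact j) \<le> C1 * (real j + 1) powr (- Re l - 1)"
      using C1(2)[of j] by (simp add: pochhammer_fact)
    have "norm (G k j) \<le> (K * (real k + 1) powr (Re l - 1)) * (C1 * (real j + 1) powr (- Re l - 1)) *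
        (C2 * ((real k + 1) powr (- d1) * (real j + 1) powr (- d2)))"
      unfolding G_def norm_mult
      by (intro mult_mono v l de mult_nonneg_nonneg) (use C1 C2 \<open>K \<ge> 0\<close> in auto)
    also have "\<dots> = K * C1 * C2 * ((real k + 1) powr (Re l - 1) * (real k + 1) powr (- d1)) *
        ((real j + 1) powr (- Re l - 1) * (real j + 1) powr (- d2))"
      by (simp only: mult_ac)
    finally show ?thesis
      by (simp flip: powr_add)
  qed
  have xy: "Re l - 1 - d1 < -1" "- Re l - 1 - d2 < -1"
    using d1 by (auto simp: d2_def)
  have "summable (\<lambda>k. C * w k)"
    by (rule sums_diagonal_rearrange(1)[OF bound xy rows])
  then have w: "summable w"
    using \<open>C \<noteq> 0\<close> by simp
  then show "summable (\<lambda>n. v n * (pochhammer d n / pochhammer (e + l) n))"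
    unfolding w_def .
  have "(\<lambda>n. \<Sum>k\<le>n. G k (n - k)) sums (\<Sum>k. C * w k)"
    by (rule sums_diagonal_rearrange(2)[OF bound xy rows])
  also have "(\<Sum>k. C * w k) = C * (\<Sum>k. w k)"
    by (rule suminf_mult[OF w])
  also have "(\<lambda>n. \<Sum>k\<le>n. G k (n - k)) = (\<lambda>n. u n * (pochhammer d n / pochhammer e n))"
    by (simp add: G_def conv sum_distrib_right sum_divide_distrib)
  finally show "(\<lambda>n. u n * (pochhammer d n / pochhammer e n)) sums
       (Gamma e * Gamma (e - d + l) / (Gamma (e - d) * Gamma (e + l)) *
        (\<Sum>n. v n * (pochhammer d n / pochhammer (e + l) n)))"
    by (simp add: C_def w_def)
qed

text \<open>As formal power series, (1 - x)^(-l) and (1 - x)^l are inverse to each other: by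
  Vandermonde the coefficients of their product are (0)_n / n!.\<close>

lemma convolution_inverse:
  fixes u v :: "nat \<Rightarrow> complex"
  assumes "\<And>n. v n = (\<Sum>k\<le>n. u k * (pochhammer l (n - k) / fact (n - k)))"
  shows "u n = (\<Sum>k\<le>n. v k * (pochhammer (- l) (n - k) / fact (n - k)))"
proof -
  define L where "L l = Abs_fps (\<lambda>n. pochhammer l n / fact n)" for l :: complex
  have "L l * L (- l) = 1"
  proof (rule fps_ext)
    fix n
    have "fps_nth (L l * L (- l)) n = (\<Sum>i\<le>n. of_nat (n choose i) * pochhammer l i * pochhammer (- l) (n - i) / fact n)"
      unfolding fps_mult_nth atMost_atLeast0
      by (intro sum.cong refl) (simp add: L_def binomial_fact)
    also have "\<dots> = pochhammer (l + - l) n / fact n"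
      by (simp only: pochhammer_binomial_sum sum_divide_distrib)
    finally show "fps_nth (L l * L (- l)) n = fps_nth 1 n"
      by (simp add: pochhammer_0_left)
  qed
  moreover have "Abs_fps v = Abs_fps u * L l"
    by (rule fps_ext) (simp add: fps_mult_nth L_def assms atMost_atLeast0)
  ultimately have "Abs_fps u = Abs_fps v * L (- l)"
    by (simp add: mult.assoc)
  from arg_cong[OF this, of "\<lambda>F. fps_nth F n"] show ?thesis
    by (simp add: fps_mult_nth L_def atMost_atLeast0)
qed

text \<open>The double series behind the previous lemma converges absolutely only for \<open>Re l < Re (e - d)\<close>.
  Otherwise the roles of \<open>u\<close> and \<open>v\<close> are exchanged, which replaces \<open>(l, e)\<close> by \<open>(- l, e + l)\<close>.\<close>

lemma euler_transform_sums:
  fixes u v :: "nat \<Rightarrow> complex"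
  assumes e: "e \<notin> \<int>\<^sub>\<le>\<^sub>0" and el: "e + l \<notin> \<int>\<^sub>\<le>\<^sub>0"
    and conv: "\<And>n. v n = (\<Sum>k\<le>n. u k * (pochhammer l (n - k) / fact (n - k)))"
    and u: "\<And>n. norm (u n) \<le> K * (real n + 1) powr (- Re l - 1)"
    and v: "\<And>n. norm (v n) \<le> K' * (real n + 1) powr (Re l - 1)"
    and re: "Re (e - d) > 0" "Re (e - d + l) > 0"
  shows "summable (\<lambda>n. v n * (pochhammer d n / pochhammer (e + l) n))"
    "(\<lambda>n. u n * (pochhammer d n / pochhammer e n)) sums
       (Gamma e * Gamma (e - d + l) / (Gamma (e - d) * Gamma (e + l)) *
        (\<Sum>n. v n * (pochhammer d n / pochhammer (e + l) n)))"
proof -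
  let ?v = "\<lambda>n. v n * (pochhammer d n / pochhammer (e + l) n)"
  let ?u = "\<lambda>n. u n * (pochhammer d n / pochhammer e n)"
  let ?C = "Gamma e * Gamma (e - d + l) / (Gamma (e - d) * Gamma (e + l))"
  have "summable ?v \<and> ?u sums (?C * (\<Sum>n. ?v n))"
  proof (cases "Re l < Re (e - d)")
    case True
    then have "\<bar>Re l\<bar> < Re (e - d)"
      using re by (auto simp: abs_if)
    from euler_transform_sums_aux[OF e el convolution_inverse[OF conv] v this] show ?thesis
      by blast
  next
    case False
    \<comment> \<open>Now Re l >= Re(e - d) > 0, hence |Re(-l)| = Re l < Re(e + l - d), which is the
      condition for the exchanged roles.\<close>
    have e': "e + l + - l \<notin> \<int>\<^sub>\<le>\<^sub>0" and conv': "\<And>n. v n = (\<Sum>k\<le>n. u k * (pochhammer (- (- l)) (n - k) / fact (n - k)))"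
      and u': "\<And>n. norm (u n) \<le> K * (real n + 1) powr (Re (- l) - 1)"
      and re': "\<bar>Re (- l)\<bar> < Re (e + l - d)"
      using e conv u re False by auto
    note aux = euler_transform_sums_aux[OF el e' conv' u' re']
    have nz: "Gamma e \<noteq> 0" "Gamma (e + l) \<noteq> 0" "Gamma (e - d) \<noteq> 0" "Gamma (e - d + l) \<noteq> 0"
      using e el re[THEN Re_pos_imp_not_nonpos_Int] by (simp_all add: Gamma_eq_zero_iff)
    have *: "?v sums (Gamma (e + l) * Gamma (e - d) / (Gamma (e - d + l) * Gamma e) * (\<Sum>n. ?u n))"
      using aux(2) by (simp add: algebra_simps)
    have vs: "(\<Sum>n. ?v n) = Gamma (e + l) * Gamma (e - d) / (Gamma (e - d + l) * Gamma e) * (\<Sum>n. ?u n)"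
      by (rule sums_unique[OF *, symmetric])
    \<comment> \<open>The constants of the two directions are reciprocal, so the exchanged identity
      can be solved for the sum of \<open>?u\<close>.\<close>
    have eq: "?C * (\<Sum>n. ?v n) = (\<Sum>n. ?u n)"
      unfolding vs using nz by simp
    have "summable ?u"
      using aux(1) by simp
    then have "?u sums (\<Sum>n. ?u n)"
      by (rule summable_sums)
    then show ?thesis
      unfolding eq using sums_summable[OF *] by blast
  qed
  then show "summable ?v" "?u sums (?C * (\<Sum>n. ?v n))"
    by blast+
qed

section \<open>The transformation formula\<close>

lemma poly_of_nat_bound:
  fixes P :: "complex poly"
  assumes "degree P \<le> m"
  obtains K where "K \<ge> 0" "\<And>n. norm (poly P (of_nat n)) \<le> K * (real n + 1) powr real m"
proof -
  define K where "K = (\<Sum>i\<le>degree P. norm (coeff P i))"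
  have "norm (poly P (of_nat n)) \<le> K * (real n + 1) powr real m" for n
  proof -
    have "norm (poly P (of_nat n)) \<le> (\<Sum>i\<le>degree P. norm (coeff P i * of_nat n ^ i))"
      unfolding poly_altdef by (rule norm_sum)
    also have "\<dots> \<le> (\<Sum>i\<le>degree P. norm (coeff P i) * (real n + 1) ^ m)"
    proof (rule sum_mono)
      fix i assume "i \<in> {..degree P}"
      then have "(real n + 1) ^ i \<le> (real n + 1) ^ m"
        using assms by (intro power_increasing) auto
      moreover have "real n ^ i \<le> (real n + 1) ^ i"
        by (intro power_mono) auto
      ultimately show "norm (coeff P i * of_nat n ^ i) \<le> norm (coeff P i) * (real n + 1) ^ m"
        unfolding norm_mult norm_power norm_of_nat by (intro mult_left_mono) auto
    qed
    finally show ?thesis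
      by (simp add: K_def sum_distrib_right powr_realpow)
  qed
  moreover have "K \<ge> 0"
    unfolding K_def by (intro sum_nonneg) auto
  ultimately show ?thesis
    using that by blast
qed

text \<open>A polynomial weight of degree at most \<open>m\<close> raises the growth exponent by at
  most \<open>m\<close>. For the coefficients before and after the Euler-type transformation this
  gives the exponents -Re l - 1 and Re l - 1.\<close>

lemma gauss_term_poly_bound:
  assumes c: "c \<notin> \<int>\<^sub>\<le>\<^sub>0" and P: "degree P \<le> m" and s: "Re (a + b - c) + real m - 1 = s"
  obtains K where "\<And>n. norm (gauss_term a b c n * poly P (of_nat n)) \<le> K * (real n + 1) powr s"
proof -
  obtain C where C: "C \<ge> 0"
    "\<And>n. norm (gauss_term a b c n) \<le> C * (real n + 1) powr (Re (a + b - c) - 1)"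
    using gauss_term_bound[OF c] by blast
  obtain K where K: "K \<ge> 0" "\<And>n. norm (poly P (of_nat n)) \<le> K * (real n + 1) powr real m"
    using poly_of_nat_bound[OF P] by blast
  have "norm (gauss_term a b c n * poly P (of_nat n)) \<le> C * K * (real n + 1) powr s" for n
  proof -
    have "norm (gauss_term a b c n * poly P (of_nat n)) \<le>
        (C * (real n + 1) powr (Re (a + b - c) - 1)) * (K * (real n + 1) powr real m)"
      unfolding norm_mult by (intro mult_mono C K) (use C K in auto)
    also have "\<dots> = C * K * ((real n + 1) powr (Re (a + b - c) - 1) * (real n + 1) powr real m)"
      by simp
    also have "(real n + 1) powr (Re (a + b - c) - 1) * (real n + 1) powr real m = (real n + 1) powr s"
      unfolding powr_add[symmetric] s[symmetric] by (simp add: algebra_simps)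
    finally show ?thesis .
  qed
  then show ?thesis
    using that by blast
qed

text \<open>The case p = 0, with \<open>Q_hat\<close> at -n still in place of the zeros. It will be
  applied with d + j for \<open>d\<close>; \<open>u\<close> and \<open>v\<close> do not involve
  \<open>d\<close>, so all these instances share them.\<close>

lemma miller_paris_sums:
  fixes a b c d e l :: complex and f :: "complex list" and ms :: "nat list"
  defines "m \<equiv> sum_list ms"
  defines "l \<equiv> c - a - b - of_nat m"
  defines "u \<equiv> \<lambda>n. gauss_term a b c n *
     ((\<Prod>y\<leftarrow>map2 (\<lambda>x q. x + of_nat q) f ms. pochhammer y n) / (\<Prod>y\<leftarrow>f. pochhammer y n))"
  defines "v \<equiv> \<lambda>n. gauss_term (c - a - of_nat m) (c - b - of_nat m) c n * Q_hat a b c f ms (- of_nat n)"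
  assumes len: "length ms = length f" and f: "set f \<inter> \<int>\<^sub>\<le>\<^sub>0 = {}" and c: "c \<notin> \<int>\<^sub>\<le>\<^sub>0"
    and A: "pochhammer (c - a - of_nat m) m \<noteq> 0" and B: "pochhammer (c - b - of_nat m) m \<noteq> 0"
    and e: "e \<notin> \<int>\<^sub>\<le>\<^sub>0" and el: "e + l \<notin> \<int>\<^sub>\<le>\<^sub>0"
    and Q: "degree (Q_hat_poly a b c f ms) \<le> m"
    and re: "Re (e - d) > 0" "Re (e - d + l) > 0"
  shows "summable (\<lambda>n. v n * (pochhammer d n / pochhammer (e + l) n))"
    "(\<lambda>n. u n * (pochhammer d n / pochhammer e n)) sums
       (Gamma e * Gamma (e - d + l) / (Gamma (e - d) * Gamma (e + l)) *
        (\<Sum>n. v n * (pochhammer d n / pochhammer (e + l) n)))"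
proof -
  obtain P where P: "degree P \<le> m"
    "\<And>t. poly P t = pochhammer_vec (map (\<lambda>x. x + t) f) ms"
    unfolding m_def using pochhammer_vec_shift_poly[where ps = ms and hs = f] by blast
  have "u n = gauss_term a b c n * poly (smult (1 / pochhammer_vec f ms) P) (of_nat n)" for n
    unfolding u_def prod_list_pochhammer_ratio[OF len f] by (simp add: P)
  moreover have "degree (smult (1 / pochhammer_vec f ms) P) \<le> m"
    using P(1) degree_smult_le order_trans by blast
  ultimately obtain K where u: "\<And>n. norm (u n) \<le> K * (real n + 1) powr (- Re l - 1)"
    using gauss_term_poly_bound[OF c, of "smult (1 / pochhammer_vec f ms) P" m a b "- Re l - 1"]
    by (auto simp: l_def)
  have "v n = gauss_term (c - a - of_nat m) (c - b - of_nat m) c n *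
      poly (Q_hat_poly a b c f ms \<circ>\<^sub>p [:0, -1:]) (of_nat n)" for n
    by (simp add: v_def poly_pcompose poly_Q_hat_poly)
  moreover have "degree (Q_hat_poly a b c f ms \<circ>\<^sub>p [:0, -1:]) \<le> m"
    using Q degree_pcompose_le[of "Q_hat_poly a b c f ms" "[:0, -1:]"] by simp
  ultimately obtain K' where v: "\<And>n. norm (v n) \<le> K' * (real n + 1) powr (Re l - 1)"
    using gauss_term_poly_bound[OF c, of "Q_hat_poly a b c f ms \<circ>\<^sub>p [:0, -1:]" m
        "c - a - of_nat m" "c - b - of_nat m" "Re l - 1"]
    by (auto simp: l_def)
  have coeff: "(\<Sum>k\<le>n. of_nat (n choose k) * pochhammer l (n - k) *
      (pochhammer a k * pochhammer b k / pochhammer c k *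
       ((\<Prod>y\<leftarrow>map2 (\<lambda>x q. x + of_nat q) f ms. pochhammer y k) / (\<Prod>y\<leftarrow>f. pochhammer y k)))) =
    pochhammer (c - a - of_nat m) n * pochhammer (c - b - of_nat m) n / pochhammer c n *
      Q_hat a b c f ms (- of_nat n)" for n
    unfolding l_def m_def
    by (rule Q_hat_coeff[OF len f pochhammer_nonzero[OF c]]) (use A B in \<open>simp_all add: m_def\<close>)
  \<comment> \<open>Division of \<open>coeff\<close> by n! turns its binomial coefficients into the
    factorials of a Cauchy product.\<close>
  have conv: "v n = (\<Sum>k\<le>n. u k * (pochhammer l (n - k) / fact (n - k)))" for n
  proof -
    have "v n = pochhammer (c - a - of_nat m) n * pochhammer (c - b - of_nat m) n / pochhammer c n *
      Q_hat a b c f ms (- of_nat n) / fact n"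
      by (simp add: v_def gauss_term_def)
    also have "\<dots> = (\<Sum>k\<le>n. of_nat (n choose k) * pochhammer l (n - k) *
      (pochhammer a k * pochhammer b k / pochhammer c k *
       ((\<Prod>y\<leftarrow>map2 (\<lambda>x q. x + of_nat q) f ms. pochhammer y k) / (\<Prod>y\<leftarrow>f. pochhammer y k)))) / fact n"
      by (simp only: coeff)
    also have "\<dots> = (\<Sum>k\<le>n. u k * (pochhammer l (n - k) / fact (n - k)))"
      unfolding sum_divide_distrib
      by (intro sum.cong refl) (simp add: u_def gauss_term_def binomial_fact mult_ac)
    finally show ?thesis .
  qed
  show "summable (\<lambda>n. v n * (pochhammer d n / pochhammer (e + l) n))"
    "(\<lambda>n. u n * (pochhammer d n / pochhammer e n)) sums
       (Gamma e * Gamma (e - d + l) / (Gamma (e - d) * Gamma (e + l)) *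
        (\<Sum>n. v n * (pochhammer d n / pochhammer (e + l) n)))"
    by (rule euler_transform_sums[OF e el conv u v re])+
qed

section \<open>Expansion of (h + n)_p in the symbols (d + n)_j\<close>

text \<open>Split (x - i)_(q + i) after q and after i factors; reflecting the two blocks of length i
  gives the same sign on both sides.\<close>

lemma pochhammer_shift_down:
  fixes x :: "'a::comm_ring_1"
  shows "pochhammer (x - of_nat i) q * pochhammer (1 - x - of_nat q) i =
    pochhammer x q * pochhammer (1 - x) i"
proof -
  have reflect: "pochhammer (y - of_nat i) i = (-1) ^ i * pochhammer (1 - y) i" for y :: 'a
    using pochhammer_minus[of "y - 1" i] by (simp add: algebra_simps)
  have "pochhammer (x - of_nat i) q * pochhammer (x - of_nat i + of_nat q) i =
      pochhammer (x - of_nat i) i * pochhammer x q"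
    using pochhammer_product'[of "x - of_nat i" q i] pochhammer_product'[of "x - of_nat i" i q]
    by (simp add: add.commute)
  moreover have "pochhammer (x - of_nat i + of_nat q) i = (-1) ^ i * pochhammer (1 - x - of_nat q) i"
    using reflect[of "x + of_nat q"] by (simp add: algebra_simps)
  ultimately have "(-1) ^ i * (pochhammer (x - of_nat i) q * pochhammer (1 - x - of_nat q) i) =
      (-1) ^ i * (pochhammer x q * pochhammer (1 - x) i)"
    by (simp add: reflect mult_ac)
  \<comment> \<open>In a commutative ring the sign is removed by multiplying with it once
    more.\<close>
  then have "(-1) ^ i * ((-1) ^ i * (pochhammer (x - of_nat i) q * pochhammer (1 - x - of_nat q) i)) =
      (-1) ^ i * ((-1) ^ i * (pochhammer x q * pochhammer (1 - x) i))"
    by (simp only:)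
  then show ?thesis
    by simp
qed

text \<open>Computes (h + t)_p at the node t = -d - i; relative to the value at t = -d, it is the
  parameter quotient of the terminating series in \<open>Y_poly\<close>.\<close>

lemma pochhammer_vec_shift_down:
  assumes "length ps = length h"
    and "set (map2 (\<lambda>x q. 1 - x + d - of_nat q) h ps) \<inter> \<int>\<^sub>\<le>\<^sub>0 = {}"
  shows "pochhammer_vec (map (\<lambda>x. x + (- d - of_nat i)) h) ps =
    pochhammer_vec (map (\<lambda>x. x - d) h) ps *
    ((\<Prod>x\<leftarrow>map (\<lambda>x. 1 - x + d) h. pochhammer x i) /
     (\<Prod>x\<leftarrow>map2 (\<lambda>x q. 1 - x + d - of_nat q) h ps. pochhammer x i))"
  using assms
proof (induction ps h rule: list_induct2)
  case (Cons q ps x h)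
  have nz: "pochhammer (1 - x + d - of_nat q) i \<noteq> 0"
    using Cons.prems by (intro pochhammer_nonzero) auto
  have step: "pochhammer (x + (- d - of_nat i)) q =
      pochhammer (x - d) q * (pochhammer (1 - x + d) i / pochhammer (1 - x + d - of_nat q) i)"
    using pochhammer_shift_down[of "x - d" i q] nz by (simp add: field_simps)
  have IH: "pochhammer_vec (map (\<lambda>x. x + (- d - of_nat i)) h) ps =
    pochhammer_vec (map (\<lambda>x. x - d) h) ps *
    ((\<Prod>x\<leftarrow>map (\<lambda>x. 1 - x + d) h. pochhammer x i) /
     (\<Prod>x\<leftarrow>map2 (\<lambda>x q. 1 - x + d - of_nat q) h ps. pochhammer x i))"
    using Cons.prems by (intro Cons.IH) auto
  have "pochhammer_vec (map (\<lambda>x. x + (- d - of_nat i)) (x # h)) (q # ps) =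
      pochhammer (x + (- d - of_nat i)) q * pochhammer_vec (map (\<lambda>x. x + (- d - of_nat i)) h) ps"
    by (simp add: pochhammer_vec_def)
  then show ?case
    unfolding step IH by (simp add: pochhammer_vec_def)
qed (simp add: pochhammer_vec_def)

text \<open>Newton interpolation of t -> (h + t)_p at -d, -d - 1, ...; the differences are the
  terminating series in \<open>Y_poly\<close>.\<close>

lemma pochhammer_vec_expansion:
  assumes len: "length ps = length h"
    and nz: "set (map2 (\<lambda>x q. 1 - x + d - of_nat q) h ps) \<inter> \<int>\<^sub>\<le>\<^sub>0 = {}"
  shows "pochhammer_vec (map (\<lambda>x. x + of_nat n) h) ps =
    (\<Sum>j\<le>sum_list ps. pochhammer_vec (map (\<lambda>x. x - d) h) ps *
      hypergeom (- of_nat j # map (\<lambda>x. 1 - x + d) h) (map2 (\<lambda>x q. 1 - x + d - of_nat q) h ps) 1 /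
      fact j * pochhammer (d + of_nat n) j)"
proof -
  obtain P where P: "degree P \<le> sum_list ps"
    "\<And>t. poly P t = pochhammer_vec (map (\<lambda>x. x + t) h) ps"
    using pochhammer_vec_shift_poly[where ps = ps and hs = h] by blast
  \<comment> \<open>The substitution t = -d - x moves the nodes to 0, 1, ...; at x = -d - n the
    basis element (-x)_j becomes (d + n)_j.\<close>
  define R where "R = P \<circ>\<^sub>p [:- d, -1:]"
  have R: "poly R x = poly P (- d - x)" for x
    by (simp add: R_def poly_pcompose)
  have "degree R \<le> sum_list ps"
    using P(1) degree_pcompose_le[of P "[:- d, -1:]"] by (simp add: R_def)
  from newton_interpolation[OF this, of "- d - of_nat n"]
  have "poly P (of_nat n) = (\<Sum>j\<le>sum_list ps. pochhammer (d + of_nat n) j / fact j *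
      (\<Sum>i\<le>j. of_nat (j choose i) * (-1) ^ i * poly P (- d - of_nat i)))"
    by (simp add: R add_ac)
  also have "\<dots> = (\<Sum>j\<le>sum_list ps. pochhammer_vec (map (\<lambda>x. x - d) h) ps *
      hypergeom (- of_nat j # map (\<lambda>x. 1 - x + d) h) (map2 (\<lambda>x q. 1 - x + d - of_nat q) h ps) 1 /
      fact j * pochhammer (d + of_nat n) j)"
  proof (rule sum.cong[OF refl])
    fix j
    have "hypergeom (- of_nat j # map (\<lambda>x. 1 - x + d) h) (map2 (\<lambda>x q. 1 - x + d - of_nat q) h ps) 1 =
        (\<Sum>i\<le>j. hypergeom_term (- of_nat j # map (\<lambda>x. 1 - x + d) h)
          (map2 (\<lambda>x q. 1 - x + d - of_nat q) h ps) 1 1 i)"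
      by (rule hypergeom_terminating) simp
    also have "\<dots> = (\<Sum>i\<le>j. of_nat (j choose i) * (-1) ^ i *
        ((\<Prod>x\<leftarrow>map (\<lambda>x. 1 - x + d) h. pochhammer x i) /
     (\<Prod>x\<leftarrow>map2 (\<lambda>x q. 1 - x + d - of_nat q) h ps. pochhammer x i)))"
      by (intro sum.cong refl) (simp add: hypergeom_term_eq pochhammer_minus_of_nat)
    finally have F: "pochhammer_vec (map (\<lambda>x. x - d) h) ps *
        hypergeom (- of_nat j # map (\<lambda>x. 1 - x + d) h) (map2 (\<lambda>x q. 1 - x + d - of_nat q) h ps) 1 =
        (\<Sum>i\<le>j. of_nat (j choose i) * (-1) ^ i * poly P (- d - of_nat i))"
      unfolding P pochhammer_vec_shift_down[OF len nz] by (simp add: sum_distrib_left mult_ac)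
    show "pochhammer (d + of_nat n) j / fact j *
      (\<Sum>i\<le>j. of_nat (j choose i) * (-1) ^ i * poly P (- d - of_nat i)) =
      pochhammer_vec (map (\<lambda>x. x - d) h) ps *
      hypergeom (- of_nat j # map (\<lambda>x. 1 - x + d) h) (map2 (\<lambda>x q. 1 - x + d - of_nat q) h ps) 1 /
      fact j * pochhammer (d + of_nat n) j"
      unfolding F by simp
  qed
  finally show ?thesis
    by (simp only: P)
qed

text \<open>Relates the Gamma factors that belong to d + j to those that belong to d.\<close>

lemma Gamma_diff_of_nat:
  fixes z :: complex
  assumes "z - of_nat j \<notin> \<int>\<^sub>\<le>\<^sub>0"
  shows "pochhammer (1 - z) j * Gamma (z - of_nat j) = (-1) ^ j * Gamma z"
proof -
  have "Gamma (z - of_nat j) \<noteq> 0"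
    using assms by (simp add: Gamma_eq_zero_iff)
  then have "Gamma z = pochhammer (z - of_nat j) j * Gamma (z - of_nat j)"
    using pochhammer_Gamma[OF assms, of j] by simp
  moreover have "pochhammer (1 - z) j = (-1) ^ j * pochhammer (z - of_nat j) j"
    using pochhammer_minus[of "z - 1" j] by simp
  ultimately show ?thesis
    by simp
qed

text \<open>The coefficient identity at N = 0, where every other factor is 1. It normalizes the
  product over the zeros.\<close>

lemma Q_hat_0:
  assumes len: "length ms = length f" and f: "set f \<inter> \<int>\<^sub>\<le>\<^sub>0 = {}"
    and A: "pochhammer (c - a - of_nat (sum_list ms)) (sum_list ms) \<noteq> 0"
    and B: "pochhammer (c - b - of_nat (sum_list ms)) (sum_list ms) \<noteq> 0"
  shows "Q_hat a b c f ms 0 = 1"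
proof -
  have "pochhammer c 0 \<noteq> 0" by simp
  from Q_hat_coeff[OF len f this A B] show ?thesis
    by (simp add: map_replicate_const)
qed

theorem theorem1:
  fixes a b c d e :: complex and f h \<zeta> :: "complex list"
    and ms ps :: "nat list" and m p :: nat
  assumes "length ms = length f" and "length ps = length h"
    and "m = sum_list ms" and "p = sum_list ps"
    and "pochhammer (1 + a + b - c) m \<noteq> 0"
    and "pochhammer (c - a - of_nat m) m \<noteq> 0"
    and "pochhammer (c - b - of_nat m) m \<noteq> 0"
    and "Re (e - d - of_nat p) > 0"
    and "Re (c + e - a - b - d - of_nat m - of_nat p) > 0"
    and "degree (Q_hat_poly a b c f ms) = m"
    and "mset \<zeta> = proots (Q_hat_poly a b c f ms)"
    and "c \<notin> \<int>\<^sub>\<le>\<^sub>0" and "e \<notin> \<int>\<^sub>\<le>\<^sub>0" and "e + c - a - b - of_nat m \<notin> \<int>\<^sub>\<le>\<^sub>0"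
    and "set f \<inter> \<int>\<^sub>\<le>\<^sub>0 = {}" and "set h \<inter> \<int>\<^sub>\<le>\<^sub>0 = {}" and "set \<zeta> \<inter> \<int>\<^sub>\<le>\<^sub>0 = {}"
    and "set (map2 (\<lambda>x q. 1 - x + d - of_nat q) h ps) \<inter> \<int>\<^sub>\<le>\<^sub>0 = {}"
  shows
    "summable (hypergeom_term
        ([a, b, d] @ map2 (\<lambda>x q. x + of_nat q) f ms @ map2 (\<lambda>x q. x + of_nat q) h ps)
        ([c, e] @ f @ h) 1 1) \<and>
     summable (hypergeom_term
        ([c - a - of_nat m, c - b - of_nat m, d] @ map (\<lambda>z. z + 1) \<zeta>)
        ([c, e + c - a - b - of_nat m] @ \<zeta>)
        (Y_poly h ps d e (c - a - b - of_nat m) 1 0) 1) \<and>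
     hypergeom
        ([a, b, d] @ map2 (\<lambda>x q. x + of_nat q) f ms @ map2 (\<lambda>x q. x + of_nat q) h ps)
        ([c, e] @ f @ h) 1 =
     Gamma (e + c - a - b - of_nat m - d) * Gamma e /
       (pochhammer_vec h ps * Gamma (e + c - a - b - of_nat m) *
        pochhammer (1 + d - e - c + a + b + of_nat m) p) *
     hypergeom_weighted
        ([c - a - of_nat m, c - b - of_nat m, d] @ map (\<lambda>z. z + 1) \<zeta>)
        ([c, e + c - a - b - of_nat m] @ \<zeta>)
        (Y_poly h ps d e (c - a - b - of_nat m) 1 0) 1"
proof -
  note len = assms(1,2) and m = assms(3) and p = assms(4) and A = assms(6) and B = assms(7)
    and re = assms(8,9) and Qdeg = assms(10) and roots = assms(11) and c = assms(12) and e = assms(13)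
    and f = assms(15) and h = assms(16) and \<zeta> = assms(17) and hd = assms(18)
  define l where "l = c - a - b - of_nat m"
  have eqs: "e + c - a - b - of_nat m = e + l" "1 + d - e - c + a + b + of_nat m = 1 - (e - d + l)"
    by (simp_all add: l_def)
  have el: "e + l \<notin> \<int>\<^sub>\<le>\<^sub>0"
    using assms(14) by (simp add: eqs)
  have re': "Re (e - (d + of_nat j)) > 0" "Re (e - (d + of_nat j) + l) > 0" if "j \<le> p" for j
  proof -
    have "real j \<le> real p" using that by simp
    then show "Re (e - (d + of_nat j)) > 0" "Re (e - (d + of_nat j) + l) > 0"
      using re by (simp_all add: l_def)
  qed
  define u where "u n = gauss_term a b c n *
     ((\<Prod>y\<leftarrow>map2 (\<lambda>x q. x + of_nat q) f ms. pochhammer y n) / (\<Prod>y\<leftarrow>f. pochhammer y n))" for n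
  define v where "v n = gauss_term (c - a - of_nat m) (c - b - of_nat m) c n *
      Q_hat a b c f ms (- of_nat n)" for n
  define z where "z j n = u n * (pochhammer (d + of_nat j) n / pochhammer e n)" for j n
  define w where "w j n = v n * (pochhammer (d + of_nat j) n / pochhammer (e + l) n)" for j n
  define C where "C j = Gamma e * Gamma (e - (d + of_nat j) + l) /
      (Gamma (e - (d + of_nat j)) * Gamma (e + l))" for j :: nat
  have zw: "summable (w j)" "z j sums (C j * (\<Sum>n. w j n))" if "j \<le> p" for j
    using miller_paris_sums[OF len(1) f c, of a b e, folded m, OF A B e el[unfolded l_def]
        eq_refl[OF Qdeg] re'[OF that, unfolded l_def]]
    unfolding z_def[abs_def] w_def[abs_def] u_def v_def C_def l_def by simp_all
  \<comment> \<open>\<open>\<alpha>\<close> and \<open>y\<close> hold the coefficients, in the basis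
    (d + n)_j, of (h + n)_p and of the polynomial Y_p(1,0;n). The second Pochhammer factor of the
    latter does not depend on n because v = 0 there.\<close>
  define \<alpha> where "\<alpha> j = pochhammer_vec (map (\<lambda>x. x - d) h) ps *
      hypergeom (- of_nat j # map (\<lambda>x. 1 - x + d) h) (map2 (\<lambda>x q. 1 - x + d - of_nat q) h ps) 1 /
      fact j" for j
  define y where "y j = \<alpha> j / Gamma (e - d) * pochhammer (d - e + 1) j *
      pochhammer (d - e - l + of_nat j + 1) (p - j)" for j
  \<comment> \<open>This turns the weight (d + n)_j into the parameter shift from d to d +
    j.\<close>
  have swap: "pochhammer d n * pochhammer (d + of_nat n) j =
      pochhammer d j * pochhammer (d + of_nat j) n" for n j
    by (metis add.commute pochhammer_product')
  let ?L = "hypergeom_term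
        ([a, b, d] @ map2 (\<lambda>x q. x + of_nat q) f ms @ map2 (\<lambda>x q. x + of_nat q) h ps)
        ([c, e] @ f @ h) 1 1"
  let ?R = "hypergeom_term
        ([c - a - of_nat m, c - b - of_nat m, d] @ map (\<lambda>z. z + 1) \<zeta>)
        ([c, e + l] @ \<zeta>) (Y_poly h ps d e l 1 0) 1"
  have L: "?L n = (\<Sum>j\<le>p. \<alpha> j * pochhammer d j / pochhammer_vec h ps * z j n)" for n
  proof -
    have "?L n = u n * (pochhammer d n / pochhammer e n) *
        ((\<Prod>x\<leftarrow>map2 (\<lambda>x q. x + of_nat q) h ps. pochhammer x n) / (\<Prod>x\<leftarrow>h. pochhammer x n))"
      by (simp add: hypergeom_term_eq u_def gauss_term_def mult_ac)
    also have "\<dots> = u n * (pochhammer d n / pochhammer e n) *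
        ((\<Sum>j\<le>p. \<alpha> j * pochhammer (d + of_nat n) j) / pochhammer_vec h ps)"
      unfolding prod_list_pochhammer_ratio[OF len(2) h] pochhammer_vec_expansion[OF len(2) hd] p \<alpha>_def ..
    also have "\<dots> = (\<Sum>j\<le>p. u n * \<alpha> j * (pochhammer d n * pochhammer (d + of_nat n) j) /
        (pochhammer e n * pochhammer_vec h ps))"
      by (simp add: sum_distrib_left sum_divide_distrib mult_ac)
    finally show ?thesis
      unfolding swap by (simp add: z_def mult_ac)
  qed
  have R: "?R n = (\<Sum>j\<le>p. y j * pochhammer d j * w j n)" for n
  proof -
    have Q0: "poly (Q_hat_poly a b c f ms) 0 = 1"
      unfolding poly_Q_hat_poly using A B by (intro Q_hat_0 len f) (simp_all add: m)
    have "?R n = gauss_term (c - a - of_nat m) (c - b - of_nat m) c n *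
        ((\<Prod>z\<leftarrow>map (\<lambda>z. z + 1) \<zeta>. pochhammer z n) / (\<Prod>z\<leftarrow>\<zeta>. pochhammer z n)) *
        (pochhammer d n / pochhammer (e + l) n) * poly (Y_poly h ps d e l 1 0) (of_nat n)"
      by (simp add: hypergeom_term_eq gauss_term_def mult_ac)
    also have "\<dots> = v n * (pochhammer d n / pochhammer (e + l) n) *
        poly (Y_poly h ps d e l 1 0) (of_nat n)"
      unfolding roots_pochhammer_ratio[OF roots \<zeta> Q0] by (simp add: v_def poly_Q_hat_poly)
    also have "poly (Y_poly h ps d e l 1 0) (of_nat n) =
        (\<Sum>j\<le>p. y j * pochhammer (d + of_nat n) j)"
      unfolding poly_Y_poly p y_def \<alpha>_def by (simp add: sum_distrib_left mult_ac add_ac)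
    also have "v n * (pochhammer d n / pochhammer (e + l) n) * (\<Sum>j\<le>p. y j * pochhammer (d + of_nat n) j) =
        (\<Sum>j\<le>p. v n * y j * (pochhammer d n * pochhammer (d + of_nat n) j) / pochhammer (e + l) n)"
      by (simp add: sum_distrib_left sum_divide_distrib mult_ac)
    finally show ?thesis
      unfolding swap by (simp add: w_def mult_ac)
  qed
  define \<Lambda> where "\<Lambda> = Gamma (e - d + l) * Gamma e /
      (pochhammer_vec h ps * Gamma (e + l) * pochhammer (1 - (e - d + l)) p)"
  \<comment> \<open>The constant \<open>C j\<close> depends on j through two Gamma factors. Stepping
    each back by j yields the Pochhammer factors of \<open>y j\<close> and part of the denominator
    of \<open>\<Lambda>\<close>; the two signs (-1)^j cancel.\<close>
  have coeff: "\<alpha> j * pochhammer d j / pochhammer_vec h ps * C j = \<Lambda> * (y j * pochhammer d j)"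
    if j: "j \<le> p" for j
  proof -
    have nz: "e - d - of_nat j \<notin> \<int>\<^sub>\<le>\<^sub>0" "e - d + l - of_nat j \<notin> \<int>\<^sub>\<le>\<^sub>0" "e - d \<notin> \<int>\<^sub>\<le>\<^sub>0"
      using re'[OF j] re'[of 0] by (auto intro!: Re_pos_imp_not_nonpos_Int)
    have top: "pochhammer (1 - (e - d + l)) p =
        pochhammer (1 - (e - d + l)) j * pochhammer (d - e - l + of_nat j + 1) (p - j)"
      using pochhammer_product[OF j, of "1 - (e - d + l)"] by (simp add: algebra_simps)
    \<comment> \<open>A zero would force e - d + l to be one of 1, ..., p, whereas its real part
      exceeds p.\<close>
    have "pochhammer (1 - (e - d + l)) p \<noteq> 0"
    proof
      assume "pochhammer (1 - (e - d + l)) p = 0"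
      then obtain k where k: "k < p" "1 - (e - d + l) = - of_nat k"
        unfolding pochhammer_eq_0_iff by blast
      then have "e - d + l = of_nat (Suc k)"
        by (simp add: algebra_simps)
      then have "e - (d + of_nat (Suc k)) + l = 0"
        by (simp add: algebra_simps)
      then have "Re (e - (d + of_nat (Suc k)) + l) = 0"
        by (simp only: zero_complex.sel)
      with re'(2)[of "Suc k"] k(1) show False
        by simp
    qed
    then have nz': "pochhammer (1 - (e - d + l)) j \<noteq> 0" "pochhammer (d - e - l + of_nat j + 1) (p - j) \<noteq> 0"
      unfolding top by auto
    have g1: "Gamma (e - d + l) = (-1) ^ j * (pochhammer (1 - (e - d + l)) j * Gamma (e - d + l - of_nat j))"
      using Gamma_diff_of_nat[OF nz(2)] by simp
    have g2: "Gamma (e - d) = (-1) ^ j * (pochhammer (d - e + 1) j * Gamma (e - d - of_nat j))"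
      using Gamma_diff_of_nat[OF nz(1)] by (simp add: algebra_simps)
    have nz'': "Gamma (e - d - of_nat j) \<noteq> 0" "pochhammer (d - e + 1) j \<noteq> 0"
      using g2 nz by (auto simp: Gamma_eq_zero_iff)
    show ?thesis
      unfolding \<Lambda>_def y_def C_def top g1 g2 using nz' nz''
      by (simp add: field_simps)
  qed
  have L': "?L sums (\<Sum>j\<le>p. \<alpha> j * pochhammer d j / pochhammer_vec h ps * (C j * (\<Sum>n. w j n)))"
    unfolding L[abs_def] by (intro sums_sum sums_mult zw) simp
  have R': "?R sums (\<Sum>j\<le>p. y j * pochhammer d j * (\<Sum>n. w j n))"
    unfolding R[abs_def] by (intro sums_sum sums_mult summable_sums zw) simp
  have "(\<Sum>j\<le>p. \<alpha> j * pochhammer d j / pochhammer_vec h ps * (C j * (\<Sum>n. w j n))) =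
      \<Lambda> * (\<Sum>j\<le>p. y j * pochhammer d j * (\<Sum>n. w j n))"
    unfolding sum_distrib_left
  proof (rule sum.cong[OF refl])
    fix j assume "j \<in> {..p}"
    then have "\<alpha> j * pochhammer d j / pochhammer_vec h ps * C j * (\<Sum>n. w j n) =
        \<Lambda> * (y j * pochhammer d j) * (\<Sum>n. w j n)"
      by (simp only: coeff atMost_iff)
    then show "\<alpha> j * pochhammer d j / pochhammer_vec h ps * (C j * (\<Sum>n. w j n)) =
        \<Lambda> * (y j * pochhammer d j * (\<Sum>n. w j n))"
      by (simp only: mult.assoc)
  qed
  then have "suminf ?L = \<Lambda> * suminf ?R"
    using L' R' by (simp only: sums_iff)
  moreover have "\<Lambda> = Gamma (e + c - a - b - of_nat m - d) * Gamma e /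
       (pochhammer_vec h ps * Gamma (e + c - a - b - of_nat m) *
        pochhammer (1 + d - e - c + a + b + of_nat m) p)"
    unfolding eqs \<Lambda>_def by (simp add: algebra_simps)
  ultimately show ?thesis
    using sums_summable[OF L'] sums_summable[OF R']
    unfolding hypergeom_weighted_def eqs(1) l_def[symmetric] by simp
qed

end
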